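(* Let $d,m\ge1$ be integers and let $U\subseteq\mathbb{R}^m$ be open and bounded. Let $A_n\to A$ in $C^{0,1}(\overline U,\mathrm{Norm}(d))$ as $n\to\infty$. Assume that $\lambda,\lambda_n\in C^{0,1}(\overline U,\mathbb{C}^d)$ are parameterizations of the eigenvalues of $A,A_n$, respectively. Assume that $\lambda_n\to\lambda$ in $L^\infty$ on $\mathcal{L}^{m-1}$-almost all line segments in $U$ parallel to the coordinate axes. Then $\partial_j\lambda_n\to\partial_j\lambda$ almost everywhere in $U$ as $n\to\infty$, for all $1\le j\le m$.
   Context: $M_d(\mathbb{C})$ is the space of complex $d\times d$ matrices with the Frobenius norm $\|\cdot\|_2$, and $\mathrm{Norm}(d)=\{A\in M_d(\mathbb{C}):A^*A=AA^*\}$. For a finite-dimensional Euclidean space $V$, $C^{0,1}(\overline U,V)$ carries the norm $\sup_{x\in U}\|f(x)\|_2+\sup_{x\ne y\in U}\frac{\|f(x)-f(y)\|_2}{\|x-y\|_2}$; $C^{0,1}(\overline U,\mathrm{Norm}(d))$ is the set of $A\in C^{0,1}(\overline U,M_d(\mathbb{C}))$ with values in $\mathrm{Norm}(d)$, with the induced topology. A parameterization of the eigenvalues of $A$ is a map $\lambda=(\lambda_1,\dots,\lambda_d):U\to\mathbb{C}^d$ such that $\lambda_1(x),\dots,\lambda_d(x)$ are the eigenvalues of $A(x)$ counted with multiplicity, for each $x\in U$. $\mathcal{L}^{m-1}$ is $(m-1)$-dimensional Lebesgue measure. The convergence assumption means: for each coordinate direction $e_j$ and for $\mathcal{L}^{m-1}$-almost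 every line $\ell$ parallel to $e_j$ (lines parametrized by their intersection with the hyperplane $x_j=0$), $\|\lambda_n-\lambda\|_{L^\infty(S)}\to0$ for every line segment $S\subseteq\ell\cap U$. *)

theory Defs
  imports
    "HOL-Analysis.Analysis"
    "HOL-Computational_Algebra.Polynomial"
    "HOL-Probability.Essential_Supremum"
begin

text \<open>The norm of \<open>complex^'d^'d\<close> is the \<open>\<ell>\<^sup>2\<close> norm of the entries, i.e. the Frobenius norm.\<close>

definition conj_transpose :: "complex^'n^'m \<Rightarrow> complex^'m^'n" where
  "conj_transpose A = (\<chi> i j. cnj (A $ j $ i))"

definition normal_matrices :: "(complex^'d^'d) set" where
  "normal_matrices = {A. conj_transpose A ** A = A ** conj_transpose A}"

definition charpoly :: "'a::comm_ring_1^'d^'d \<Rightarrow> 'a poly" where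
  "charpoly A = det (\<chi> i j. (if i = j then [:0, 1:] else 0) - [:A $ i $ j:])"

text \<open>The entries of \<open>l\<close> are the eigenvalues of \<open>A\<close>, each \<open>z\<close> occurring exactly as often as
  its algebraic multiplicity (which is \<open>0\<close> if \<open>z\<close> is not an eigenvalue).\<close>

definition eigenvalues_with_mult :: "complex^'d^'d \<Rightarrow> complex^'d \<Rightarrow> bool" where
  "eigenvalues_with_mult A l \<longleftrightarrow> (\<forall>z. card {i. l $ i = z} = order z (charpoly A))"

definition eigenvalue_parameterization ::
    "'a set \<Rightarrow> ('a \<Rightarrow> complex^'d^'d) \<Rightarrow> ('a \<Rightarrow> complex^'d) \<Rightarrow> bool" where
  "eigenvalue_parameterization U A l \<longleftrightarrow> (\<forall>x\<in>U. eigenvalues_with_mult (A x) (l x))"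

text \<open>Elements of \<open>C\<^sup>0\<^sup>,\<^sup>1\<close> on the closure of \<open>U\<close> are represented by total functions, whose
  values outside the closure are irrelevant. The norm takes the value \<open>\<infinity>\<close> on functions that are
  unbounded or not Lipschitz on \<open>U\<close>.\<close>

definition C01_norm :: "'a::real_normed_vector set \<Rightarrow> ('a \<Rightarrow> 'b::real_normed_vector) \<Rightarrow> ennreal" where
  "C01_norm U f =
     (SUP x\<in>U. ennreal (norm (f x))) +
     (SUP (x, y)\<in>{(x, y). x \<in> U \<and> y \<in> U \<and> x \<noteq> y}. ennreal (norm (f x - f y) / norm (x - y)))"

definition C01 :: "'a::real_normed_vector set \<Rightarrow> ('a \<Rightarrow> 'b::real_normed_vector) set" where
  "C01 U = {f. continuous_on (closure U) f \<and> C01_norm U f < \<infinity>}"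

definition C01_normal :: "'a::real_normed_vector set \<Rightarrow> ('a \<Rightarrow> complex^'d^'d) set" where
  "C01_normal U = {A \<in> C01 U. \<forall>x\<in>closure U. A x \<in> normal_matrices}"

definition C01_tendsto ::
    "'a::real_normed_vector set \<Rightarrow> (nat \<Rightarrow> 'a \<Rightarrow> 'b::real_normed_vector) \<Rightarrow> ('a \<Rightarrow> 'b) \<Rightarrow> bool" where
  "C01_tendsto U F f \<longleftrightarrow> (\<lambda>n. C01_norm U (\<lambda>x. F n x - f x)) \<longlonglongrightarrow> 0"

definition Linf_norm :: "'a measure \<Rightarrow> ('a \<Rightarrow> 'b::real_normed_vector) \<Rightarrow> ennreal" where
  "Linf_norm M f = esssup M (\<lambda>t. ennreal (norm (f t)))"

text \<open>A line parallel to the \<open>j\<close>-th axis is given by its point in the hyperplane \<open>x\<^sub>j = 0\<close>, recorded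
  by the remaining coordinates \<open>y\<close>; it is traversed with unit speed by \<open>axis_line j y\<close>. The product
  measure below, on functions with index set \<open>UNIV - {j}\<close>, is the Lebesgue measure on that
  hyperplane (a unit point mass if there are no other coordinates).\<close>

definition axis_line :: "'m \<Rightarrow> ('m \<Rightarrow> real) \<Rightarrow> real \<Rightarrow> real^'m" where
  "axis_line j y t = (\<chi> i. if i = j then t else y i)"

definition tendsto_Linf_on_axis_segments ::
    "(real^'m) set \<Rightarrow> (nat \<Rightarrow> real^'m \<Rightarrow> 'b::real_normed_vector) \<Rightarrow> (real^'m \<Rightarrow> 'b) \<Rightarrow> bool" where
  "tendsto_Linf_on_axis_segments U F f \<longleftrightarrow>
     (\<forall>j. AE y in Pi\<^sub>M (UNIV - {j}) (\<lambda>_. lborel :: real measure).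
        \<forall>a b. a < b \<and> axis_line j y ` {a..b} \<subseteq> U \<longrightarrow>
          (\<lambda>n. Linf_norm (lebesgue_on {a..b})
                 (\<lambda>t. F n (axis_line j y t) - f (axis_line j y t))) \<longlonglongrightarrow> 0)"

definition partially_differentiable ::
    "'m \<Rightarrow> (real^'m \<Rightarrow> 'b::real_normed_vector) \<Rightarrow> real^'m \<Rightarrow> bool" where
  "partially_differentiable j f x \<longleftrightarrow> (\<lambda>t. f (x + t *\<^sub>R axis j 1)) differentiable (at (0::real))"

definition partial_deriv ::
    "'m \<Rightarrow> (real^'m \<Rightarrow> 'b::real_normed_vector) \<Rightarrow> real^'m \<Rightarrow> 'b" where
  "partial_deriv j f x = vector_derivative (\<lambda>t. f (x + t *\<^sub>R axis j 1)) (at (0::real))"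

end

theory Submission
  imports Defs "HOL-Computational_Algebra.Fundamental_Theorem_Algebra"
begin

text \<open>
  On almost every line parallel to an axis everything in sight is differentiable almost everywhere,
  so the question is pointwise along a line. Let \<open>B\<close> be a curve of normal matrices and \<open>\<mu>\<close> a
  differentiable eigenvalue of it. Limits of unit eigenvectors yield a unit vector \<open>v\<close> in the
  \<open>\<mu>(0)\<close>-eigenspace of \<open>B(0)\<close> with \<open>\<mu>'(0) = \<langle>B'(0) v, v\<rangle>\<close>. Applied to \<open>A\<^sub>n\<close>, this exhibits each limit
  point of \<open>\<partial>\<^sub>j\<lambda>\<^sub>n\<^sub>,\<^sub>i\<close> as \<open>\<langle>\<partial>\<^sub>jA v, v\<rangle>\<close> for some unit \<open>v\<close> in the \<open>\<lambda>\<^sub>i\<close>-eigenspace of \<open>A\<close>. At a single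
  point different \<open>v\<close> may give different values; but almost everywhere \<open>\<lambda>\<^sub>i = \<lambda>\<^sub>k\<close> forces
  \<open>\<partial>\<^sub>j\<lambda>\<^sub>i = \<partial>\<^sub>j\<lambda>\<^sub>k\<close>, and then, by the spectral theorem, the form \<open>\<langle>\<partial>\<^sub>jA v, v\<rangle>\<close> is constantly
  \<open>\<partial>\<^sub>j\<lambda>\<^sub>i\<close> on the unit vectors of that eigenspace.
\<close>

section \<open>Lipschitz functions\<close>

text \<open>Rademacher's theorem on the line. A steep linear term makes \<open>f\<close> increasing;
  the increments are then integrals of a Radon-Nikodym density, and Lebesgue differentiation
  recovers the derivative almost everywhere.\<close>

lemma AE_differentiable_lipschitz_real:
  fixes f :: "real \<Rightarrow> real"
  assumes f: "L-lipschitz_on UNIV f"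
  shows "AE t in lborel. f differentiable (at t)"
proof -
  have L0: "L \<ge> 0" using f lipschitz_on_nonneg by blast
  have fL: "\<bar>f x - f y\<bar> \<le> L * \<bar>x - y\<bar>" for x y
    using lipschitz_onD[OF f, of x y] by (simp add: dist_real_def)
  \<comment> \<open>\<open>F\<close> is a bi-Lipschitz homeomorphism of the line, so its Stieltjes measure is just the image of
    Lebesgue measure under the inverse of \<open>F\<close>; its density is the derivative.\<close>
  define F where "F t = f t + (L + 1) * t" for t
  \<comment> \<open>The slope \<open>L + 1\<close> exceeds the largest possible descent of
    \<open>f\<close> by 1, so \<open>F\<close> is expanding; this gives both strict monotonicity and
    surjectivity.\<close>
  have F_grow: "F b - F a \<ge> b - a" if "a \<le> b" for a b
    using fL[of b a] that by (simp add: F_def algebra_simps abs_le_iff)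
  have F_lip: "(2 * L + 1)-lipschitz_on UNIV F"
  proof (rule lipschitz_onI)
    fix x y :: real
    have "\<bar>F x - F y\<bar> \<le> \<bar>f x - f y\<bar> + \<bar>(L + 1) * (x - y)\<bar>"
      unfolding F_def by (smt (verit) right_diff_distrib)
    also have "\<dots> \<le> L * \<bar>x - y\<bar> + (L + 1) * \<bar>x - y\<bar>"
      using fL[of x y] L0 by (simp add: abs_mult)
    finally show "dist (F x) (F y) \<le> (2 * L + 1) * dist x y"
      by (simp add: dist_real_def algebra_simps)
  qed (use L0 in simp)
  have F_smono: "strict_mono F"
    by (intro strict_monoI) (use F_grow in \<open>smt (verit)\<close>)
  have F_cont: "continuous_on UNIV F"
    using F_lip lipschitz_on_continuous_on by blast
  have F_surj: "surj F"
  proof -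
    have "\<exists>x. F x = y" for y
    proof -
      define r where "r = \<bar>y - F 0\<bar>"
      have "F (- r) \<le> y" using F_grow[of "-r" 0] by (simp add: r_def)
      moreover have "y \<le> F r" using F_grow[of 0 r] by (simp add: r_def)
      moreover have "- r \<le> r" by (simp add: r_def)
      ultimately show ?thesis
        using IVT'[of F "-r" y r] continuous_on_subset[OF F_cont] by blast
    qed
    then show ?thesis unfolding surj_def by metis
  qed
  define G where "G = inv F"
  have inj: "inj F" using F_smono strict_mono_imp_inj_on by blast
  have GF: "G (F x) = x" and FG: "F (G y) = y" for x y
    by (simp_all add: G_def inj F_surj surj_f_inv_f)
  have less_iff: "a < G y \<longleftrightarrow> F a < y" and le_iff: "G y \<le> a \<longleftrightarrow> y \<le> F a" for a y
    using strict_mono_less[OF F_smono, of a "G y"] strict_mono_less_eq[OF F_smono, of "G y" a]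
    by (simp_all add: FG)
  have "mono G"
    using le_iff FG by (metis monoI)
  then have G_meas [measurable]: "G \<in> borel_measurable borel"
    by (rule borel_measurable_mono)
  define M where "M = distr lborel borel G"
  have M_Ioc: "emeasure M {a<..b} = ennreal (F b - F a)" if "a \<le> b" for a b
  proof -
    have "G -` {a<..b} = {F a<..F b}"
      by (auto simp: less_iff le_iff)
    moreover have "F a \<le> F b" using F_grow[OF that] that by simp
    ultimately show ?thesis
      by (simp add: M_def emeasure_distr)
  qed
  \<comment> \<open>The preimage of \<open>N\<close> under \<open>G\<close> is the image of
    \<open>N\<close> under the Lipschitz map \<open>F\<close>, and Lipschitz maps preserve
    negligible sets.\<close>
  have AC: "absolutely_continuous lborel M"
    unfolding absolutely_continuous_def
  proof
    fix N :: "real set" assume N: "N \<in> null_sets lborel"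
    then have Nb [measurable]: "N \<in> sets borel" by auto
    from N have "negligible N"
      by (simp add: negligible_iff_null_sets null_sets_completionI)
    then have "negligible (F ` N)"
    proof (rule negligible_locally_Lipschitz_image[rotated])
      fix x
      have "norm (F y - F x) \<le> (2 * L + 1) * norm (y - x)" for y
        using lipschitz_onD[OF F_lip, of y x] by (simp add: dist_norm)
      then show "\<exists>T B. open T \<and> x \<in> T \<and> (\<forall>y\<in>N \<inter> T. norm (F y - F x) \<le> B * norm (y - x))"
        by (intro exI[of _ UNIV]) auto
    qed simp
    moreover have eq: "G -` N = F ` N"
      by (auto simp: GF image_iff) (metis FG)
    ultimately have "G -` N \<in> null_sets lebesgue"
      by (simp add: negligible_iff_null_sets)
    moreover have "G -` N \<in> sets lborel"
      using measurable_sets[OF G_meas Nb] by simp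
    ultimately have "G -` N \<in> null_sets lborel"
      using null_sets_completion_iff by blast
    then show "N \<in> null_sets M"
      using Nb by (auto simp: M_def null_sets_def emeasure_distr)
  qed
  obtain g where g [measurable]: "g \<in> borel_measurable borel" and gM: "density lborel g = M"
    using sigma_finite_measure.Radon_Nikodym[OF sigma_finite_lborel AC] by (auto simp: M_def)
  have g_fin: "AE x in lborel. g x \<noteq> \<infinity>"
  proof -
    have "AE x in lborel. x \<in> {- real n<..real n} \<longrightarrow> g x \<noteq> \<infinity>" for n :: nat
    proof -
      have "(\<integral>\<^sup>+x. g x * indicator {- real n<..real n} x \<partial>lborel) = emeasure M {- real n<..real n}"
        unfolding gM[symmetric] by (rule emeasure_density[symmetric]) auto
      also have "\<dots> \<noteq> \<infinity>" by (simp add: M_Ioc)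
      finally have "AE x in lborel. g x * indicator {- real n<..real n} x \<noteq> \<infinity>"
        by (intro nn_integral_PInf_AE) auto
      then show ?thesis by eventually_elim auto
    qed
    then have "AE x in lborel. \<forall>n. x \<in> {- real n<..real n} \<longrightarrow> g x \<noteq> \<infinity>"
      unfolding AE_all_countable by blast
    then show ?thesis
    proof eventually_elim
      case (elim x)
      obtain n where "real n > \<bar>x\<bar>" using reals_Archimedean2 by blast
      then have "x \<in> {- real n<..real n}" by auto
      with elim show ?case by blast
    qed
  qed
  \<comment> \<open>\<open>enn2real\<close> sends \<infinity> to 0; by \<open>g_fin\<close> this
    changes the density only on a null set.\<close>
  define h where "h x = enn2real (g x)" for x
  have h_int: "(h has_integral (F b - F a)) {a..b}" if ab: "a \<le> b" for a b
  proof -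
    have "((\<lambda>x. h x * indicator {a<..b} x) has_integral (F b - F a)) UNIV"
    proof (rule nn_integral_has_integral)
      show "0 \<le> F b - F a" using F_grow[OF ab] ab by simp
      have "(\<integral>\<^sup>+x. ennreal (h x * indicator {a<..b} x) \<partial>lborel) = (\<integral>\<^sup>+x. g x * indicator {a<..b} x \<partial>lborel)"
        using g_fin by (intro nn_integral_cong_AE) (auto elim!: eventually_mono simp: h_def indicator_def top.not_eq_extremum)
      also have "\<dots> = emeasure M {a<..b}"
        unfolding gM[symmetric] by (rule emeasure_density[symmetric]) auto
      finally show "(\<integral>\<^sup>+x. ennreal (h x * indicator {a<..b} x) \<partial>lborel) = ennreal (F b - F a)"
        using M_Ioc[OF ab] by simp
    qed (auto simp: h_def)
    also have "(\<lambda>x. h x * indicator {a<..b} x) = (\<lambda>x. if x \<in> {a<..b} then h x else 0)"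
      by auto
    finally have "(h has_integral (F b - F a)) {a<..b}"
      by (simp only: has_integral_restrict_UNIV)
    then show ?thesis
      by (subst has_integral_spike_set_eq[of _ "{a<..b}"]) (auto intro: negligible_subset[of "{a}"])
  qed
  \<comment> \<open>The library's Lebesgue differentiation theorem is one-sided, hence it is applied both to \<open>h\<close> and
    to its reflection.\<close>
  have "h integrable_on cbox a b" for a b
    using h_int[of a b] by (cases "a \<le> b") (auto simp: integrable_on_def)
  then obtain N1 where N1: "negligible N1"
    "\<And>x e. \<lbrakk>x \<notin> N1; 0 < e\<rbrakk> \<Longrightarrow> \<exists>d>0. \<forall>s. 0 < s \<and> s < d \<longrightarrow>
        norm (integral (cbox x (x + s *\<^sub>R One)) h /\<^sub>R s ^ DIM(real) - h x) < e"
    using integrable_ccontinuous_explicit[of h] by blast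
  have h_int': "((\<lambda>x. h (- x)) has_integral (F (-a) - F (-b))) {a..b}" if "a \<le> b" for a b
    using h_int[of "-b" "-a"] that
    has_integral_reflect_real[of h "F (-a) - F (-b)" "-a" "-b"] by simp
  have "(\<lambda>x. h (- x)) integrable_on cbox a b" for a b
    using h_int'[of a b] by (cases "a \<le> b") (auto simp: integrable_on_def)
  then obtain N2 where N2: "negligible N2"
    "\<And>x e. \<lbrakk>x \<notin> N2; 0 < e\<rbrakk> \<Longrightarrow> \<exists>d>0. \<forall>s. 0 < s \<and> s < d \<longrightarrow>
        norm (integral (cbox x (x + s *\<^sub>R One)) (\<lambda>x. h (- x)) /\<^sub>R s ^ DIM(real) - h (- x)) < e"
    using integrable_ccontinuous_explicit[of "\<lambda>x. h (- x)"] by blast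
  have neg: "negligible (N1 \<union> uminus ` N2)"
    using N1 N2 by (auto intro!: negligible_differentiable_image_negligible simp: differentiable_on_def)
  have diff: "f differentiable (at x)" if x: "x \<notin> N1 \<union> uminus ` N2" for x
  proof -
    have "((\<lambda>s. (F (x + s) - F x) / s) \<longlongrightarrow> h x) (at 0)"
    proof (rule LIM_I)
      fix e :: real assume e: "e > 0"
      obtain d1 where d1: "d1 > 0" "\<And>s. 0 < s \<Longrightarrow> s < d1 \<Longrightarrow> \<bar>(F (x + s) - F x) / s - h x\<bar> < e"
      proof -
        obtain d where "d > 0" "\<And>s. 0 < s \<Longrightarrow> s < d \<Longrightarrow>
            norm (integral (cbox x (x + s *\<^sub>R One)) h /\<^sub>R s ^ DIM(real) - h x) < e"
          using N1(2)[of x e] x e by blast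
        moreover have "integral (cbox x (x + s *\<^sub>R One)) h = F (x + s) - F x" if "0 < s" for s
          using h_int[of x "x + s"] that by (simp add: integral_unique)
        ultimately show ?thesis
          by (intro that[of d]) (auto simp: divide_inverse mult.commute)
      qed
      obtain d2 where d2: "d2 > 0" "\<And>s. 0 < s \<Longrightarrow> s < d2 \<Longrightarrow> \<bar>(F x - F (x - s)) / s - h x\<bar> < e"
      proof -
        have "- x \<notin> N2" using x by (force simp: image_iff)
        then obtain d where "d > 0" "\<And>s. 0 < s \<Longrightarrow> s < d \<Longrightarrow>
            norm (integral (cbox (-x) (-x + s *\<^sub>R One)) (\<lambda>x. h (- x)) /\<^sub>R s ^ DIM(real) - h (- (- x))) < e"
          using N2(2)[of "-x" e] e by blast
        moreover have "integral (cbox (-x) (-x + s *\<^sub>R One)) (\<lambda>x. h (- x)) = F x - F (x - s)" if "0 < s" for s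
          using h_int'[of "-x" "-x + s"] that by (simp add: integral_unique)
        ultimately show ?thesis
          by (intro that[of d]) (auto simp: divide_inverse mult.commute)
      qed
      show "\<exists>s>0. \<forall>t. t \<noteq> 0 \<and> norm (t - 0) < s \<longrightarrow> norm ((F (x + t) - F x) / t - h x) < e"
      proof (intro exI[of _ "min d1 d2"] conjI allI impI)
        fix t :: real assume t: "t \<noteq> 0 \<and> norm (t - 0) < min d1 d2"
        show "norm ((F (x + t) - F x) / t - h x) < e"
        proof (cases "t > 0")
          case True then show ?thesis using d1(2)[of t] t by auto
        next
          case False
          have "(F (x + t) - F x) / t = (F x - F (x - (- t))) / (- t)"
            by (simp add: minus_divide_left)
          then show ?thesis using d2(2)[of "-t"] t False by auto
        qed
      qed (use d1 d2 in auto)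
    qed
    then have "(F has_field_derivative h x) (at x)"
      by (simp add: DERIV_def)
    then have "((\<lambda>t. F t - (L + 1) * t) has_field_derivative h x - (L + 1)) (at x)"
      by (intro derivative_eq_intros) auto
    then show ?thesis
      unfolding real_differentiable_def by (auto simp: F_def)
  qed
  have "AE t in lebesgue. t \<notin> N1 \<union> uminus ` N2"
    using neg unfolding negligible_iff_null_sets by (rule AE_not_in)
  then have "AE t in lebesgue. f differentiable (at t)"
    by eventually_elim (use diff in blast)
  then show ?thesis by (simp add: AE_completion_iff)
qed

section \<open>Extension of Lipschitz functions to the whole space\<close>

lemma lipschitz_extension_real:
  fixes f :: "'a::metric_space \<Rightarrow> real"
  assumes f: "L-lipschitz_on U f"
  obtains g where "L-lipschitz_on UNIV g" "\<And>x. x \<in> U \<Longrightarrow> g x = f x"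
proof (cases "U = {}")
  case True
  have "L \<ge> 0" using f lipschitz_on_nonneg by blast
  then show ?thesis using True by (intro that[of "\<lambda>_. 0"]) (auto simp: lipschitz_on_def)
next
  case False
  have L0: "L \<ge> 0" using f lipschitz_on_nonneg by blast
  \<comment> \<open>McShane's extension\<close>
  define g where "g x = (INF u\<in>U. f u + L * dist x u)" for x
  have lower: "f v - L * dist x v \<le> f u + L * dist x u" if "u \<in> U" "v \<in> U" for x u v
  proof -
    have "f v - f u \<le> L * dist v u"
      using lipschitz_onD[OF f that(2,1)] by (simp add: dist_real_def)
    also have "\<dots> \<le> L * (dist x v + dist x u)"
      by (intro mult_left_mono dist_triangle3 L0)
    finally show ?thesis by (simp add: algebra_simps)
  qed
  then have bdd: "bdd_below ((\<lambda>u. f u + L * dist x u) ` U)" for x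
    using False by (meson bdd_belowI2 ex_in_conv)
  have "g x \<le> g y + L * dist x y" for x y
  proof -
    have "g x - L * dist x y \<le> f u + L * dist y u" if u: "u \<in> U" for u
    proof -
      have "g x \<le> f u + L * dist x u"
        unfolding g_def by (rule cINF_lower[OF bdd u])
      also have "\<dots> \<le> f u + L * (dist x y + dist y u)"
        by (intro add_left_mono mult_left_mono dist_triangle L0)
      finally show ?thesis by (simp add: algebra_simps)
    qed
    then have "g x - L * dist x y \<le> g y"
      unfolding g_def[of y] using False by (intro cINF_greatest)
    then show ?thesis by simp
  qed
  note g_le = this
  have "L-lipschitz_on UNIV g"
  proof (rule lipschitz_onI[OF _ L0])
    show "dist (g x) (g y) \<le> L * dist x y" for x y
      using g_le[of x y] g_le[of y x] by (simp add: dist_real_def abs_le_iff dist_commute)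
  qed
  moreover have "g x = f x" if "x \<in> U" for x
  proof (rule antisym)
    show "g x \<le> f x" unfolding g_def using cINF_lower[OF bdd that, of x] by simp
    show "f x \<le> g x" unfolding g_def using False lower[OF _ that, of _ x] by (intro cINF_greatest) auto
  qed
  ultimately show ?thesis by (rule that)
qed

lemma lipschitz_on_inner_Basis:
  fixes f :: "'a::metric_space \<Rightarrow> 'b::euclidean_space"
  assumes f: "L-lipschitz_on U f" and b: "b \<in> Basis"
  shows "L-lipschitz_on U (\<lambda>x. f x \<bullet> b)"
proof (rule lipschitz_onI[OF _ lipschitz_on_nonneg[OF f]])
  fix x y assume "x \<in> U" "y \<in> U"
  have "dist (f x \<bullet> b) (f y \<bullet> b) \<le> dist (f x) (f y)"
    using Basis_le_norm[OF b, of "f x - f y"] by (simp add: dist_norm inner_diff_left)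
  also have "\<dots> \<le> L * dist x y" by (rule lipschitz_onD[OF f]) fact+
  finally show "dist (f x \<bullet> b) (f y \<bullet> b) \<le> L * dist x y" .
qed

text \<open>Lets functions given on \<open>U\<close> be studied along complete axis lines, which may
  leave \<open>U\<close>. Each coordinate is extended separately; this enlarges the constant by the
  dimension, which is harmless where only some constant is wanted.\<close>

lemma lipschitz_extension:
  fixes f :: "'a::metric_space \<Rightarrow> 'b::euclidean_space"
  assumes f: "L-lipschitz_on U f"
  obtains K g where "K-lipschitz_on UNIV g" "\<And>x. x \<in> U \<Longrightarrow> g x = f x"
proof -
  have L0: "L \<ge> 0" using f lipschitz_on_nonneg by blast
  have "\<exists>g. L-lipschitz_on UNIV g \<and> (\<forall>x\<in>U. g x = f x \<bullet> b)" if "b \<in> Basis" for b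
    using lipschitz_extension_real[OF lipschitz_on_inner_Basis[OF f that]] by metis
  then obtain g where g: "\<And>b. b \<in> Basis \<Longrightarrow> L-lipschitz_on UNIV (g b)"
      "\<And>b x. b \<in> Basis \<Longrightarrow> x \<in> U \<Longrightarrow> g b x = f x \<bullet> b"
    by metis
  have "(DIM('b) * L)-lipschitz_on UNIV (\<lambda>x. \<Sum>b\<in>Basis. g b x *\<^sub>R b)"
  proof (rule lipschitz_onI)
    fix x y :: 'a
    have "dist (\<Sum>b\<in>Basis. g b x *\<^sub>R b) (\<Sum>b\<in>Basis. g b y *\<^sub>R b)
        = norm (\<Sum>b\<in>Basis. (g b x - g b y) *\<^sub>R b)"
      by (simp add: dist_norm sum_subtractf scaleR_diff_left)
    also have "\<dots> \<le> (\<Sum>b\<in>(Basis :: 'b set). L * dist x y)"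
      using lipschitz_onD[OF g(1)] by (intro sum_norm_le) (auto simp: dist_real_def)
    finally show "dist (\<Sum>b\<in>Basis. g b x *\<^sub>R b) (\<Sum>b\<in>Basis. g b y *\<^sub>R b) \<le> DIM('b) * L * dist x y"
      by (simp add: algebra_simps)
  qed (use L0 in simp)
  moreover have "(\<Sum>b\<in>Basis. g b x *\<^sub>R b) = f x" if "x \<in> U" for x
    using that g(2) by (simp add: euclidean_representation)
  ultimately show ?thesis by (rule that)
qed

section \<open>Lines parallel to the axes\<close>

lemma axis_line_add: "axis_line j y t + s *\<^sub>R axis j 1 = axis_line j y (t + s)"
  by (simp add: axis_line_def axis_def vec_eq_iff)

lemma axis_line_component [simp]: "axis_line j y t $ i = (if i = j then t else y i)"
  by (simp add: axis_line_def)

lemma measurable_axis_line: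
  "(\<lambda>(y, t). axis_line (j :: 'm::finite) y t) \<in>
     Pi\<^sub>M (UNIV - {j}) (\<lambda>_. lborel) \<Otimes>\<^sub>M lborel \<rightarrow>\<^sub>M borel"
proof -
  have "(\<lambda>p. axis_line j (fst p) (snd p) \<bullet> b) \<in> borel_measurable (Pi\<^sub>M (UNIV - {j}) (\<lambda>_. lborel) \<Otimes>\<^sub>M lborel)"
    if "b \<in> Basis" for b
  proof -
    from that obtain i where b: "b = axis i 1" by (auto simp: Basis_vec_def)
    show ?thesis
    proof (cases "i = j")
      case True
      then show ?thesis by (simp add: b inner_axis)
    next
      case False
      have "(\<lambda>p. fst p i) \<in> borel_measurable (Pi\<^sub>M (UNIV - {j}) (\<lambda>_. lborel :: real measure) \<Otimes>\<^sub>M (lborel :: real measure))"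
        using False by (intro measurable_compose[OF measurable_fst] measurable_component_singleton[where M="\<lambda>_. lborel", simplified]) auto
      then show ?thesis using False by (simp add: b inner_axis)
    qed
  qed
  then have "(\<lambda>p. axis_line j (fst p) (snd p)) \<in> borel_measurable (Pi\<^sub>M (UNIV - {j}) (\<lambda>_. lborel) \<Otimes>\<^sub>M lborel)"
    by (subst borel_measurable_euclidean_space) blast
  then show ?thesis by (simp add: case_prod_beta')
qed

text \<open>Lebesgue measure is determined by the volumes of boxes, and the preimage of a box is a
  product from which the \<open>j\<close>-th side has been split off. This puts Fubini's theorem at
  disposal in an arbitrary coordinate direction.\<close>

lemma lborel_eq_distr_axis_line:
  fixes j :: "'m::finite"
  shows "lborel = distr (Pi\<^sub>M (UNIV - {j}) (\<lambda>_. lborel) \<Otimes>\<^sub>M lborel) borel (\<lambda>(y, t). axis_line j y t)"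
    (is "_ = distr ?P _ ?T")
proof (rule lborel_eqI)
  interpret product_sigma_finite "\<lambda>_::'m. lborel :: real measure" ..
  interpret fp: finite_product_sigma_finite "\<lambda>_::'m. lborel :: real measure" "UNIV - {j}" by standard simp
  fix l u :: "real^'m" assume le: "\<And>b. b \<in> Basis \<Longrightarrow> l \<bullet> b \<le> u \<bullet> b"
  have le': "l $ i \<le> u $ i" for i
    using le[of "axis i 1"] by (simp add: inner_axis)
  have "?T -` box l u \<inter> space ?P = (\<Pi>\<^sub>E i\<in>UNIV - {j}. {l $ i<..<u $ i}) \<times> {l $ j<..<u $ j}"
  proof (rule set_eqI)
    fix p :: "('m \<Rightarrow> real) \<times> real"
    obtain y t where p: "p = (y, t)" by (cases p)
    have "p \<in> ?T -` box l u \<inter> space ?P \<longleftrightarrow>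
        y \<in> extensional (UNIV - {j}) \<and> (\<forall>i. l $ i < axis_line j y t $ i \<and> axis_line j y t $ i < u $ i)"
      by (simp add: p space_pair_measure space_PiM mem_box_cart PiE_def conj_commute)
    also have "(\<forall>i. l $ i < axis_line j y t $ i \<and> axis_line j y t $ i < u $ i) \<longleftrightarrow>
        (\<forall>i\<in>UNIV - {j}. y i \<in> {l $ i<..<u $ i}) \<and> t \<in> {l $ j<..<u $ j}"
      by force
    finally show "p \<in> ?T -` box l u \<inter> space ?P \<longleftrightarrow>
        p \<in> (\<Pi>\<^sub>E i\<in>UNIV - {j}. {l $ i<..<u $ i}) \<times> {l $ j<..<u $ j}"
      by (simp only: p mem_Times_iff fst_conv snd_conv PiE_def Int_iff Pi_iff conj_ac)
  qed
  then have "emeasure (distr ?P borel ?T) (box l u)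
      = emeasure ?P ((\<Pi>\<^sub>E i\<in>UNIV - {j}. {l $ i<..<u $ i}) \<times> {l $ j<..<u $ j})"
    by (simp add: emeasure_distr[OF measurable_axis_line])
  also have "\<dots> = emeasure (Pi\<^sub>M (UNIV - {j}) (\<lambda>_. lborel)) (\<Pi>\<^sub>E i\<in>UNIV - {j}. {l $ i<..<u $ i}) * emeasure lborel {l $ j<..<u $ j}"
    by (rule lborel.emeasure_pair_measure_Times) auto
  also have "\<dots> = (\<Prod>i\<in>UNIV - {j}. ennreal (u $ i - l $ i)) * ennreal (u $ j - l $ j)"
    using le' by (subst emeasure_PiM) auto
  also have "\<dots> = (\<Prod>i\<in>UNIV. ennreal (u $ i - l $ i))"
    using prod.remove[of UNIV j "\<lambda>i. ennreal (u $ i - l $ i)"] by (simp only: finite UNIV_I mult.commute simp_thms)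
  also have "\<dots> = ennreal (\<Prod>i\<in>UNIV. u $ i - l $ i)"
    using le' by (intro prod_ennreal) simp
  also have "(\<Prod>i\<in>UNIV. u $ i - l $ i) = (\<Prod>b\<in>Basis. (u - l) \<bullet> b)"
  proof -
    have "(Basis :: (real^'m) set) = (\<lambda>i. axis i 1) ` UNIV" by (auto simp: Basis_vec_def)
    moreover have "inj (\<lambda>i::'m. axis i (1::real))" by (auto simp: inj_on_def axis_eq_axis)
    ultimately have "(\<Prod>b\<in>Basis. (u - l) \<bullet> b) = (\<Prod>i\<in>(UNIV :: 'm set). (u - l) \<bullet> axis i 1)"
      by (metis (no_types, lifting) prod.reindex_cong)
    then show ?thesis by (simp add: inner_axis)
  qed
  finally show "emeasure (distr ?P borel ?T) (box l u) = (\<Prod>b\<in>Basis. (u - l) \<bullet> b)" .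
qed simp

text \<open>The direction of Fubini's theorem that passes from lines to the space. Here
  \<open>S\<close> has to be Borel, since null sections alone do not make the complement of
  \<open>S\<close> a null set.\<close>

lemma AE_lborel_axis_lines:
  fixes S :: "(real^'m) set"
  assumes S: "S \<in> sets borel"
    and ae: "AE y in Pi\<^sub>M (UNIV - {j}) (\<lambda>_. lborel). AE t in lborel. axis_line j y t \<in> S"
  shows "AE x in lborel. x \<in> S"
proof -
  interpret product_sigma_finite "\<lambda>_::'m. lborel :: real measure" ..
  interpret fp: finite_product_sigma_finite "\<lambda>_::'m. lborel :: real measure" "UNIV - {j}" by standard simp
  interpret pair_sigma_finite "Pi\<^sub>M (UNIV - {j}) (\<lambda>_. lborel :: real measure)" "lborel :: real measure" ..
  have "AE p in Pi\<^sub>M (UNIV - {j}) (\<lambda>_. lborel) \<Otimes>\<^sub>M lborel. (case p of (y, t) \<Rightarrow> axis_line j y t) \<in> S"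
  proof (rule AE_pair_measure)
    show "{p \<in> space (Pi\<^sub>M (UNIV - {j}) (\<lambda>_. lborel) \<Otimes>\<^sub>M lborel). (case p of (y, t) \<Rightarrow> axis_line j y t) \<in> S}
        \<in> sets (Pi\<^sub>M (UNIV - {j}) (\<lambda>_. lborel) \<Otimes>\<^sub>M lborel)"
      using measurable_sets[OF measurable_axis_line S] by (simp add: vimage_def Int_def conj_commute)
  qed (use ae in simp)
  then show ?thesis
    by (subst lborel_eq_distr_axis_line[of j], subst AE_distr_iff[OF measurable_axis_line]) (use S in auto)
qed

text \<open>A form of the Cauchy criterion made for measurability: the unknown limit is gone, the
  tolerances run over the countable family \<open>1 / Suc n\<close>, and the final inequality is
  non-strict, so that its violation is an open condition when \<open>q\<close> depends continuously
  on a parameter.\<close>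

lemma LIM_at_iff_Cauchy:
  fixes q :: "real \<Rightarrow> real"
  shows "(\<exists>l. q \<midarrow>0\<rightarrow> l) \<longleftrightarrow>
    (\<forall>n. \<exists>m. \<forall>h k. h \<noteq> 0 \<and> \<bar>h\<bar> < 1 / Suc m \<and> k \<noteq> 0 \<and> \<bar>k\<bar> < 1 / Suc m \<longrightarrow> \<bar>q h - q k\<bar> \<le> 1 / Suc n)"
    (is "?L \<longleftrightarrow> ?R")
proof
  assume ?L
  then obtain l where l: "q \<midarrow>0\<rightarrow> l" by blast
  show ?R
  proof
    fix n
    define e where "e = 1 / real (Suc n) / 2"
    have e: "e > 0" "1 / real (Suc n) = 2 * e" by (simp_all add: e_def del: of_nat_Suc)
    obtain d where d: "d > 0" "\<And>h. h \<noteq> 0 \<Longrightarrow> \<bar>h\<bar> < d \<Longrightarrow> \<bar>q h - l\<bar> < e"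
      using LIM_D[OF l \<open>e > 0\<close>] by auto
    obtain m where m: "1 / real (Suc m) < d"
      using reals_Archimedean[OF \<open>d > 0\<close>] by (auto simp: inverse_eq_divide)
    have "\<bar>q h - q k\<bar> \<le> 1 / Suc n"
      if "h \<noteq> 0 \<and> \<bar>h\<bar> < 1 / Suc m \<and> k \<noteq> 0 \<and> \<bar>k\<bar> < 1 / Suc m" for h k
    proof -
      have "\<bar>q h - l\<bar> < e" "\<bar>q k - l\<bar> < e"
        using d(2)[of h] d(2)[of k] that m by linarith+
      then show ?thesis unfolding e(2) by linarith
    qed
    then show "\<exists>m. \<forall>h k. h \<noteq> 0 \<and> \<bar>h\<bar> < 1 / Suc m \<and> k \<noteq> 0 \<and> \<bar>k\<bar> < 1 / Suc m \<longrightarrow> \<bar>q h - q k\<bar> \<le> 1 / Suc n"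
      by blast
  qed
next
  assume R: ?R
  have small: "\<exists>d>0. \<forall>h k. h \<noteq> 0 \<and> \<bar>h\<bar> < d \<and> k \<noteq> 0 \<and> \<bar>k\<bar> < d \<longrightarrow> \<bar>q h - q k\<bar> < e" if "e > 0" for e
  proof -
    obtain n where n: "1 / real (Suc n) < e"
      using reals_Archimedean[OF \<open>e > 0\<close>] by (auto simp: inverse_eq_divide)
    obtain m where m: "\<And>h k. h \<noteq> 0 \<and> \<bar>h\<bar> < 1 / Suc m \<and> k \<noteq> 0 \<and> \<bar>k\<bar> < 1 / Suc m \<Longrightarrow> \<bar>q h - q k\<bar> \<le> 1 / Suc n"
      using R by blast
    show ?thesis
      by (intro exI[of _ "1 / Suc m"]) (use m n in \<open>auto intro!: le_less_trans[OF _ n]\<close>)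
  qed
  \<comment> \<open>The candidate limit is found along the single sequence \<open>1 / Suc n\<close>;
    the Cauchy condition then carries it over to all small \<open>h\<close>.\<close>
  define X where "X n = q (1 / Suc n)" for n :: nat
  have to0: "(\<lambda>n. 1 / real (Suc n)) \<longlonglongrightarrow> 0"
    using LIMSEQ_inverse_real_of_nat by (simp add: inverse_eq_divide)
  have ev: "eventually (\<lambda>n. 1 / real (Suc n) < d) sequentially" if "d > 0" for d
    using order_tendstoD(2)[OF to0 that] .
  have "Cauchy X"
  proof (rule metric_CauchyI)
    fix e :: real assume "e > 0"
    from small[OF this] obtain d where "d > 0" and
        small_d: "\<forall>h k. h \<noteq> 0 \<and> \<bar>h\<bar> < d \<and> k \<noteq> 0 \<and> \<bar>k\<bar> < d \<longrightarrow> \<bar>q h - q k\<bar> < e"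
      by blast
    from small_d have d: "\<And>h k. h \<noteq> 0 \<Longrightarrow> \<bar>h\<bar> < d \<Longrightarrow> k \<noteq> 0 \<Longrightarrow> \<bar>k\<bar> < d \<Longrightarrow> \<bar>q h - q k\<bar> < e"
      by simp
    obtain N where N: "\<And>n. n \<ge> N \<Longrightarrow> 1 / real (Suc n) < d"
      using ev[OF \<open>d > 0\<close>] unfolding eventually_sequentially by blast
    show "\<exists>M. \<forall>m\<ge>M. \<forall>n\<ge>M. dist (X m) (X n) < e"
      unfolding X_def dist_real_def
      by (intro exI[of _ N] allI impI d) (use N in \<open>auto simp del: of_nat_Suc\<close>)
  qed
  then obtain l where l: "X \<longlonglongrightarrow> l"
    using Cauchy_convergent_iff convergent_def by blast
  have "q \<midarrow>0\<rightarrow> l"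
  proof (rule LIM_I)
    fix e :: real assume "e > 0"
    then have "e / 2 > 0" by simp
    from small[OF this] obtain d where "d > 0" and
        small_d: "\<forall>h k. h \<noteq> 0 \<and> \<bar>h\<bar> < d \<and> k \<noteq> 0 \<and> \<bar>k\<bar> < d \<longrightarrow> \<bar>q h - q k\<bar> < e / 2"
      by blast
    from small_d have d: "\<And>h k. h \<noteq> 0 \<Longrightarrow> \<bar>h\<bar> < d \<Longrightarrow> k \<noteq> 0 \<Longrightarrow> \<bar>k\<bar> < d \<Longrightarrow> \<bar>q h - q k\<bar> < e / 2"
      by simp
    have "\<bar>q h - l\<bar> < e" if h: "h \<noteq> 0" "\<bar>h\<bar> < d" for h
    proof -
      have "eventually (\<lambda>n. \<bar>q h - X n\<bar> \<le> e / 2) sequentially"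
        using ev[OF \<open>d > 0\<close>]
      proof eventually_elim
        case (elim n)
        then have "\<bar>q h - X n\<bar> < e / 2"
          unfolding X_def by (intro d h) (simp_all del: of_nat_Suc)
        then show ?case by simp
      qed
      then have "\<bar>q h - l\<bar> \<le> e / 2"
        by (intro tendsto_upperbound[OF tendsto_rabs[OF tendsto_diff[OF tendsto_const l]]]) simp_all
      then show ?thesis using \<open>e > 0\<close> by simp
    qed
    then show "\<exists>s>0. \<forall>x. x \<noteq> 0 \<and> norm (x - 0) < s \<longrightarrow> norm (q x - l) < e"
      using \<open>d > 0\<close> by auto
  qed
  then show ?L by blast
qed

lemma partially_differentiable_iff_LIM:
  fixes f :: "real^'m \<Rightarrow> real"
  shows "partially_differentiable j f x \<longleftrightarrow> (\<exists>l. (\<lambda>h. (f (x + h *\<^sub>R axis j 1) - f x) / h) \<midarrow>0\<rightarrow> l)"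
  by (simp add: partially_differentiable_def real_differentiable_def DERIV_def)

text \<open>Supplies the measurability that \<open>AE_lborel_axis_lines\<close> demands.\<close>

lemma borel_partially_differentiable:
  fixes f :: "real^'m \<Rightarrow> real"
  assumes f: "continuous_on UNIV f"
  shows "{x. partially_differentiable j f x} \<in> sets borel"
proof -
  define q where "q x h = (f (x + h *\<^sub>R axis j 1) - f x) / h" for x h
  define B where "B n h k = {x. 1 / real (Suc n) < \<bar>q x h - q x k\<bar>}" for n :: nat and h k
  define J where "J m = {(h, k). h \<noteq> 0 \<and> \<bar>h\<bar> < 1 / real (Suc m) \<and> k \<noteq> 0 \<and> \<bar>k\<bar> < 1 / real (Suc m)}" for m :: nat
  have q_cont: "continuous_on UNIV (\<lambda>x. q x h)" for h
    unfolding q_def divide_inverse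
    by (intro continuous_intros continuous_on_compose2[OF f] f) auto
  have "open (B n h k)" for n h k
    unfolding B_def by (intro open_Collect_less continuous_intros q_cont)
  then have Un: "(\<Union>(h, k)\<in>J m. B n h k) \<in> sets borel" for n m
    by (intro borel_open open_UN) auto
  \<comment> \<open>the inner unions are uncountable, but open\<close>
  have "{x. partially_differentiable j f x} = (\<Inter>n. \<Union>m. - (\<Union>(h, k)\<in>J m. B n h k))"
    unfolding partially_differentiable_iff_LIM LIM_at_iff_Cauchy q_def[symmetric]
    by (force simp: J_def B_def not_less)
  also have "\<dots> \<in> sets borel"
    by (intro sets.countable_INT'' sets.countable_UN'' borel_comp Un) auto
  finally show ?thesis .
qed

section \<open>Almost everywhere existence of partial derivatives\<close>

lemma dist_axis_line: "dist (axis_line j y s) (axis_line j y t) = \<bar>s - t\<bar>"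
proof -
  have "axis_line j y s = axis_line j y t + (s - t) *\<^sub>R axis j 1"
    by (simp add: axis_line_add)
  then show ?thesis by (simp add: dist_norm norm_axis_1)
qed

text \<open>The restriction of \<open>f\<close> to any axis line is Lipschitz with the same
  constant, because axis lines are isometric. The one-dimensional theorem applies on each of them,
  and Fubini's theorem collects the lines.\<close>

lemma AE_partially_differentiable_real:
  fixes f :: "real^'m \<Rightarrow> real"
  assumes f: "L-lipschitz_on UNIV f"
  shows "AE x in lborel. partially_differentiable j f x"
proof -
  have "AE t in lborel. axis_line j y t \<in> {x. partially_differentiable j f x}" for y
  proof -
    have "L-lipschitz_on UNIV (\<lambda>t. f (axis_line j y t))"
      using lipschitz_onD[OF f] lipschitz_on_nonneg[OF f]
      by (intro lipschitz_onI) (auto simp: dist_axis_line[symmetric, of _ _ j y] dist_real_def)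
    then have "AE t in lborel. (\<lambda>t. f (axis_line j y t)) differentiable (at t)"
      by (rule AE_differentiable_lipschitz_real)
    then show ?thesis
    proof eventually_elim
      case (elim t)
      \<comment> \<open>The base point is written \<open>0 + t\<close> so that
        \<open>DERIV_shift\<close> can move it to 0.\<close>
      then obtain D where "((\<lambda>t. f (axis_line j y t)) has_real_derivative D) (at (0 + t))"
        by (auto simp: real_differentiable_def)
      then have "((\<lambda>s. f (axis_line j y (s + t))) has_real_derivative D) (at 0)"
        by (simp only: DERIV_shift)
      then show ?case
        by (auto simp: partially_differentiable_def real_differentiable_def axis_line_add add.commute)
    qed
  qed
  then have "AE x in lborel. x \<in> {x. partially_differentiable j f x}"
    by (intro AE_lborel_axis_lines[of _ j] borel_partially_differentiable lipschitz_on_continuous_on[OF f]) auto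
  then show ?thesis by simp
qed

lemma AE_partially_differentiable:
  fixes f :: "real^'m \<Rightarrow> 'b::euclidean_space"
  assumes f: "L-lipschitz_on UNIV f"
  shows "AE x in lborel. partially_differentiable j f x"
proof -
  have "AE x in lborel. partially_differentiable j (\<lambda>x. f x \<bullet> b) x" if "b \<in> Basis" for b
    using lipschitz_on_inner_Basis[OF f that] by (rule AE_partially_differentiable_real)
  then have "AE x in lborel. \<forall>b\<in>Basis. partially_differentiable j (\<lambda>x. f x \<bullet> b) x"
    by (intro AE_ball_countable' countable_finite) auto
  then show ?thesis
    unfolding partially_differentiable_def
    by eventually_elim (simp add: differentiable_componentwise_within[of "\<lambda>t. f (_ + t *\<^sub>R axis j 1)"])
qed

text \<open>Meant for the difference of two eigenvalue components: it shows that almost everywhere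
  on the set where they coincide, their partial derivatives coincide too.\<close>

lemma AE_zero_imp_partial_deriv_zero:
  fixes h :: "real^'m \<Rightarrow> 'b::real_normed_vector"
  assumes h: "L-lipschitz_on UNIV h"
  shows "AE x in lborel. h x = 0 \<longrightarrow> ((\<lambda>t. h (x + t *\<^sub>R axis j 1)) has_vector_derivative 0) (at 0)"
proof -
  \<comment> \<open>At a zero of \<open>h\<close> the Lipschitz function \<open>norm \<circ> h\<close> is minimal, so its derivative vanishes there.\<close>
  have "L-lipschitz_on UNIV (\<lambda>x. norm (h x))"
  proof (rule lipschitz_onI)
    fix x y :: "real^'m"
    have "dist (norm (h x)) (norm (h y)) \<le> dist (h x) (h y)"
      by (simp add: dist_norm norm_triangle_ineq3)
    also have "\<dots> \<le> L * dist x y" by (rule lipschitz_onD[OF h]) auto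
    finally show "dist (norm (h x)) (norm (h y)) \<le> L * dist x y" .
  qed (rule lipschitz_on_nonneg[OF h])
  then have "AE x in lborel. partially_differentiable j (\<lambda>x. norm (h x)) x"
    by (rule AE_partially_differentiable_real)
  then show ?thesis
  proof eventually_elim
    case (elim x)
    show ?case
    proof
      assume 0: "h x = 0"
      obtain D where D: "((\<lambda>t. norm (h (x + t *\<^sub>R axis j 1))) has_real_derivative D) (at 0)"
        using elim by (auto simp: partially_differentiable_def real_differentiable_def)
      have "D = 0"
        by (rule DERIV_local_min[OF D, of 1]) (auto simp: 0)
      \<comment> \<open>For derivative 0 at a zero of \<open>h\<close>, the defining limit involves
        only the norm of \<open>h\<close>, so it is the same condition for \<open>h\<close> and for
        its norm.\<close>
      with D have "((\<lambda>t. norm (h (x + t *\<^sub>R axis j 1))) has_derivative (\<lambda>_. 0)) (at 0)"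
        by (auto simp: has_field_derivative_def lambda_zero)
      then show "((\<lambda>t. h (x + t *\<^sub>R axis j 1)) has_vector_derivative 0) (at 0)"
        by (simp add: has_vector_derivative_def has_derivative_at 0)
    qed
  qed
qed

text \<open>If a continuous function exceeded its essential supremum at an interior point, it would
  do so on a nonempty open set, which is not negligible.\<close>

lemma norm_le_Linf_norm:
  fixes \<phi> :: "real \<Rightarrow> 'b::real_normed_vector"
  assumes \<phi>: "continuous_on {a..b} \<phi>" and t: "a < t" "t < b"
  shows "ennreal (norm (\<phi> t)) \<le> Linf_norm (lebesgue_on {a..b}) \<phi>"
proof (rule ccontr)
  define c where "c = Linf_norm (lebesgue_on {a..b}) \<phi>"
  assume "\<not> ?thesis"
  then have less: "c < ennreal (norm (\<phi> t))" by (simp add: c_def)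
  then obtain r where r: "c = ennreal r" "r \<ge> 0" by (cases c) auto
  define W where "W = (\<lambda>x. norm (\<phi> x)) -` {r<..} \<inter> {a<..<b}"
  have "continuous_on {a<..<b} (\<lambda>x. norm (\<phi> x))"
    by (intro continuous_on_norm continuous_on_subset[OF \<phi>]) auto
  then have "open W"
    unfolding W_def by (subst (asm) continuous_on_open_vimage) auto
  moreover have "t \<in> W"
    using less r t by (simp add: W_def ennreal_less_iff)
  moreover have "negligible W"
  proof -
    have "AE x in lebesgue_on {a..b}. ennreal (norm (\<phi> x)) \<le> c"
      unfolding c_def Linf_norm_def by (rule esssup_AE)
    then have "AE x in lebesgue. x \<in> {a..b} \<longrightarrow> ennreal (norm (\<phi> x)) \<le> c"
      by (simp add: AE_restrict_space_iff)
    then have "AE x in lebesgue. x \<notin> W"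
      by eventually_elim (use r in \<open>auto simp: W_def\<close>)
    moreover have "W \<in> sets lebesgue"
      using \<open>open W\<close> by auto
    ultimately show ?thesis
      by (simp add: negligible_iff_null_sets AE_iff_null_sets)
  qed
  ultimately show False
    using open_not_negligible by blast
qed

lemma AE_tendsto_if_tendsto_Linf_on_axis_segments:
  fixes U :: "(real^'m) set" and F :: "nat \<Rightarrow> real^'m \<Rightarrow> 'b::{second_countable_topology, real_normed_vector}"
  assumes U: "open U"
    and G: "\<And>n. continuous_on UNIV (G n)" "\<And>n x. x \<in> U \<Longrightarrow> G n x = F n x"
    and g: "continuous_on UNIV g" "\<And>x. x \<in> U \<Longrightarrow> g x = f x"
    and lim: "tendsto_Linf_on_axis_segments U F f"
  shows "AE x in lborel. x \<in> U \<longrightarrow> (\<lambda>n. F n x) \<longlonglongrightarrow> f x"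
proof -
  \<comment> \<open>Convergence is spelled out with countably many tolerances and in terms of the
    continuous functions \<open>G\<close> and \<open>g\<close>, which makes \<open>S\<close> visibly
    Borel.\<close>
  define S where "S = {x. x \<in> U \<longrightarrow> (\<forall>i. \<exists>N. \<forall>n\<ge>N. dist (G n x) (g x) < 1 / real (Suc i))}"
  have S_iff: "x \<in> S \<longleftrightarrow> (x \<in> U \<longrightarrow> (\<lambda>n. F n x) \<longlonglongrightarrow> f x)" for x
  proof (cases "x \<in> U")
    case True
    have "(\<lambda>n. G n x) \<longlonglongrightarrow> g x \<longleftrightarrow> (\<forall>i. \<exists>N. \<forall>n\<ge>N. dist (G n x) (g x) < 1 / real (Suc i))"
      (is "_ \<longleftrightarrow> ?R")
    proof
      assume ?R
      show "(\<lambda>n. G n x) \<longlonglongrightarrow> g x"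
      proof (rule metric_LIMSEQ_I)
        fix e :: real assume "e > 0"
        then obtain i where "1 / real (Suc i) < e"
          using reals_Archimedean by (auto simp: inverse_eq_divide)
        with \<open>?R\<close> show "\<exists>N. \<forall>n\<ge>N. dist (G n x) (g x) < e"
          by (meson less_trans)
      qed
    qed (use metric_LIMSEQ_D in fastforce)
    then show ?thesis using True G(2) g(2) by (simp add: S_def)
  qed (simp add: S_def)
  have [measurable]: "G n \<in> borel_measurable borel" "g \<in> borel_measurable borel" for n
    using G(1) g(1) by (auto intro: borel_measurable_continuous_onI)
  have [measurable]: "U \<in> sets borel" using U by auto
  have S: "S \<in> sets borel"
    unfolding S_def by measurable
  \<comment> \<open>\<open>undefined\<close> serves as an arbitrary fixed coordinate direction; each
    point lies on exactly one line parallel to it.\<close>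
  have "AE y in Pi\<^sub>M (UNIV - {undefined}) (\<lambda>_. lborel :: real measure). AE t in lborel. axis_line (undefined :: 'm) y t \<in> S"
    using lim[unfolded tendsto_Linf_on_axis_segments_def, rule_format, of undefined]
  proof eventually_elim
    case (elim y)
    let ?p = "axis_line (undefined :: 'm) y"
    have "(\<lambda>n. F n (?p t)) \<longlonglongrightarrow> f (?p t)" if t: "?p t \<in> U" for t
    proof -
      obtain e where e: "e > 0" "ball (?p t) e \<subseteq> U"
        using U t open_contains_ball by blast
      define a b where "a = t - e / 2" and "b = t + e / 2"
      have sub: "?p ` {a..b} \<subseteq> U"
        using e by (intro order_trans[OF _ e(2)]) (auto simp: dist_axis_line a_def b_def)
      have ab: "a < t" "t < b" using e by (auto simp: a_def b_def)
      let ?\<phi> = "\<lambda>n s. F n (?p s) - f (?p s)"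
      have L: "(\<lambda>n. Linf_norm (lebesgue_on {a..b}) (?\<phi> n)) \<longlonglongrightarrow> 0"
        using elim sub ab by simp
      have "continuous_on {a..b} ?p"
        unfolding continuous_on_iff by (auto simp: dist_axis_line dist_real_def)
      then have cont: "continuous_on {a..b} (\<lambda>s. G n (?p s) - g (?p s))" for n
        by (intro continuous_intros continuous_on_compose2[OF G(1)] continuous_on_compose2[OF g(1)]) auto
      have "continuous_on {a..b} (?\<phi> n)" for n
        by (rule continuous_on_eq[OF cont[of n]]) (use sub in \<open>simp add: G(2) g(2) image_subset_iff\<close>)
      then have "ennreal (norm (?\<phi> n t)) \<le> Linf_norm (lebesgue_on {a..b}) (?\<phi> n)" for n
        by (rule norm_le_Linf_norm[OF _ ab])
      then have "(\<lambda>n. ennreal (norm (?\<phi> n t))) \<longlonglongrightarrow> 0"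
        by (intro tendsto_sandwich[OF _ _ tendsto_const L]) auto
      then have "(\<lambda>n. norm (?\<phi> n t)) \<longlonglongrightarrow> 0"
        by (simp add: tendsto_ennreal_iff flip: ennreal_0)
      then show ?thesis
        using LIM_zero_iff tendsto_norm_zero_iff by blast
    qed
    then show ?case by (simp add: S_iff)
  qed
  from AE_lborel_axis_lines[OF S this] show ?thesis by (simp add: S_iff)
qed

section \<open>Eigenvectors of normal matrices\<close>

text \<open>The Hermitian inner product, linear in the first argument. The real inner product
  \<open>inner\<close> on these vectors is its real part.\<close>

definition cinner :: "complex^'n \<Rightarrow> complex^'n \<Rightarrow> complex" where
  "cinner v w = (\<Sum>i\<in>UNIV. v $ i * cnj (w $ i))"

lemma cinner_commute: "cinner w v = cnj (cinner v w)"
  by (simp add: cinner_def mult.commute)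

lemma cinner_add_left: "cinner (u + v) w = cinner u w + cinner v w"
  by (simp add: cinner_def distrib_right sum.distrib)

lemma cinner_add_right: "cinner w (u + v) = cinner w u + cinner w v"
  by (simp add: cinner_def distrib_left sum.distrib)

lemma cinner_diff_left: "cinner (u - v) w = cinner u w - cinner v w"
  by (simp add: cinner_def left_diff_distrib sum_subtractf)

lemma cinner_diff_right: "cinner w (u - v) = cinner w u - cinner w v"
  by (simp add: cinner_def right_diff_distrib sum_subtractf)

lemma cinner_scale_left: "cinner (c *s v) w = c * cinner v w"
  by (simp add: cinner_def sum_distrib_left mult.assoc)

lemma cinner_scale_right: "cinner v (c *s w) = cnj c * cinner v w"
  by (simp add: cinner_def sum_distrib_left mult_ac)

lemma cinner_scaleR_left: "cinner (r *\<^sub>R v) w = of_real r * cinner v w"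
  by (simp add: cinner_def sum_distrib_left scaleR_conv_of_real[where 'a = complex] mult.assoc)

lemma cinner_zero_left [simp]: "cinner 0 w = 0"
  by (simp add: cinner_def)

lemma cinner_zero_right [simp]: "cinner w 0 = 0"
  by (simp add: cinner_def)

lemma cinner_sum_left: "cinner (\<Sum>k\<in>K. f k) w = (\<Sum>k\<in>K. cinner (f k) w)"
  by (induction K rule: infinite_finite_induct) (simp_all add: cinner_add_left)

lemma cinner_sum_right: "cinner w (\<Sum>k\<in>K. f k) = (\<Sum>k\<in>K. cinner w (f k))"
  by (induction K rule: infinite_finite_induct) (simp_all add: cinner_add_right)

lemma inner_eq_Re_cinner: "v \<bullet> w = Re (cinner v w)"
  by (simp add: inner_vec_def cinner_def inner_complex_def)

lemma cinner_self: "cinner v v = complex_of_real ((norm v)\<^sup>2)"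
proof -
  have "Im (cinner v v) = 0"
    by (simp add: cinner_def)
  moreover have "Re (cinner v v) = (norm v)\<^sup>2"
    by (simp add: inner_eq_Re_cinner[symmetric] dot_square_norm)
  ultimately show ?thesis by (simp add: complex_eq_iff)
qed

lemma tendsto_cinner [tendsto_intros]:
  assumes "(f \<longlongrightarrow> v) F" "(g \<longlongrightarrow> w) F"
  shows "((\<lambda>x. cinner (f x) (g x)) \<longlongrightarrow> cinner v w) F"
  unfolding cinner_def by (intro tendsto_intros assms)

lemma tendsto_matrix_vector_mult [tendsto_intros]:
  fixes A :: "'a \<Rightarrow> complex^'n^'m"
  assumes "(A \<longlongrightarrow> B) F" "(f \<longlongrightarrow> v) F"
  shows "((\<lambda>x. A x *v f x) \<longlongrightarrow> B *v v) F"
  unfolding matrix_vector_mult_def by (intro tendsto_vec_lambda tendsto_intros assms)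

lemma tendsto_vector_scalar_mult [tendsto_intros]:
  fixes f :: "'a \<Rightarrow> complex^'n"
  assumes "(c \<longlongrightarrow> a) F" "(f \<longlongrightarrow> v) F"
  shows "((\<lambda>x. c x *s f x) \<longlongrightarrow> a *s v) F"
  unfolding vector_scalar_mult_def by (intro tendsto_vec_lambda tendsto_intros assms)

lemma cinner_conj_transpose:
  fixes A :: "complex^'n^'m"
  shows "cinner (A *v v) w = cinner v (conj_transpose A *v w)"
  by (simp add: cinner_def conj_transpose_def matrix_vector_mult_def sum_distrib_left sum_distrib_right mult_ac)
     (rule sum.swap)

lemma cinner_conj_transpose':
  fixes A :: "complex^'n^'m"
  shows "cinner (conj_transpose A *v v) w = cinner v (A *v w)"
  by (metis cinner_commute cinner_conj_transpose)

text \<open>Normality gives \<open>A\<close> and its adjoint the same norm on \<open>v\<close>. With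
  this, the squared norm of the residual \<open>?r\<close> expands to four terms that
  cancel.\<close>

lemma normal_eigenvector_conj_transpose:
  assumes A: "A \<in> normal_matrices" and v: "A *v v = \<mu> *s v"
  shows "conj_transpose A *v v = cnj \<mu> *s v"
proof -
  have "cinner (conj_transpose A *v v) (conj_transpose A *v v) = cinner (A *v v) (A *v v)"
    using A by (metis (mono_tags, lifting) A cinner_conj_transpose cinner_conj_transpose' matrix_vector_mul_assoc mem_Collect_eq normal_matrices_def)
  also have "\<dots> = \<mu> * cnj \<mu> * cinner v v"
    by (simp add: v cinner_scale_left cinner_scale_right)
  finally have 1: "cinner (conj_transpose A *v v) (conj_transpose A *v v) = \<mu> * cnj \<mu> * cinner v v" .
  have 2: "cinner (conj_transpose A *v v) v = cnj \<mu> * cinner v v"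
    by (simp add: cinner_conj_transpose' v cinner_scale_right)
  then have 3: "cinner v (conj_transpose A *v v) = \<mu> * cinner v v"
    by (subst cinner_commute) (simp add: cinner_commute[of v v, symmetric])
  let ?r = "conj_transpose A *v v - cnj \<mu> *s v"
  have "cinner ?r ?r = 0"
    by (simp add: cinner_diff_left cinner_diff_right cinner_scale_left cinner_scale_right 1 2 3)
  then show ?thesis by (simp add: cinner_self)
qed

section \<open>Eigenvectors in invariant sets and the spectral theorem\<close>

lemma mem_span_image_lessThan:
  fixes f :: "nat \<Rightarrow> 'a::real_vector"
  assumes "x \<in> span (f ` {..<n})"
  shows "\<exists>c. x = (\<Sum>k<n. c k *\<^sub>R f k)"
  using assms
proof (induction n arbitrary: x)
  case (Suc n)
  then obtain a where "x - a *\<^sub>R f n \<in> span (f ` {..<n})"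
    by (auto simp: lessThan_Suc span_breakdown_eq)
  then obtain c where c: "x - a *\<^sub>R f n = (\<Sum>k<n. c k *\<^sub>R f k)"
    using Suc.IH by blast
  have "x = (\<Sum>k<Suc n. (c(n := a)) k *\<^sub>R f k)"
    using c by (simp add: algebra_simps)
  then show ?case by blast
qed simp

text \<open>Otherwise the sequence would have arbitrarily long independent initial pieces. Applied
  to the iterates of a matrix on a vector, this yields a polynomial relation between them.\<close>

lemma exists_mem_span_previous:
  fixes f :: "nat \<Rightarrow> 'a::euclidean_space"
  shows "\<exists>n. f n \<in> span (f ` {..<n})"
proof (rule ccontr)
  assume "\<not> ?thesis"
  then have notin: "f n \<notin> span (f ` {..<n})" for n by blast
  have "independent (f ` {..<n}) \<and> card (f ` {..<n}) = n" for n
  proof (induction n)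
    case (Suc n)
    have "f n \<notin> f ` {..<n}"
      using notin[of n] span_base[of "f n" "f ` {..<n}"] by argo
    then have "card (insert (f n) (f ` {..<n})) = Suc n"
      using Suc by simp
    moreover have "independent (insert (f n) (f ` {..<n}))"
      using Suc notin[of n] independent_insertI by blast
    ultimately show ?case unfolding lessThan_Suc image_insert by blast
  qed (simp add: independent_empty)
  then show False
    using independent_bound[of "f ` {..<DIM('a) + 1}"] by (metis Suc_eq_plus1 Suc_n_not_le_n)
qed

text \<open>Split a linear factor with root \<open>a\<close> off \<open>p\<close>. Either
  \<open>A *v v - a *s v\<close> vanishes and \<open>v\<close> is an eigenvector, or it is a nonzero
  element of \<open>S\<close> annihilated by the remaining factor, whose degree is smaller.\<close>

lemma exists_eigenvector_if_annihilated_by_poly: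
  fixes A :: "complex^'n^'n"
  assumes inv: "\<And>v a. v \<in> S \<Longrightarrow> A *v v - a *s v \<in> S"
    and "p \<noteq> 0" "degree p \<le> n" "v \<in> S" "v \<noteq> 0"
    and "(\<Sum>k\<le>n. coeff p k *s ((*v) A ^^ k) v) = 0"
  shows "\<exists>u\<in>S. u \<noteq> 0 \<and> (\<exists>\<mu>. A *v u = \<mu> *s u)"
  using assms(2-)
proof (induction n arbitrary: p v)
  case 0
  then have "coeff p 0 \<noteq> 0" using leading_coeff_0_iff[of p] by simp
  with 0 show ?case by simp
next
  case (Suc n)
  show ?case
  proof (cases "degree p = 0")
    case True
    then have c0: "coeff p 0 \<noteq> 0" using Suc.prems(1) leading_coeff_0_iff[of p] by simp
    have "(\<Sum>k\<le>Suc n. coeff p k *s ((*v) A ^^ k) v) = coeff p 0 *s v"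
      using True by (subst sum.atMost_Suc_shift) (simp add: coeff_eq_0)
    with Suc.prems c0 show ?thesis by simp
  next
    case False
    then obtain a where "poly p a = 0"
      using fundamental_theorem_of_algebra[of p] by (metis constant_degree)
    then obtain q where q: "p = [:- a, 1:] * q" by (auto simp: poly_eq_0_iff_dvd)
    with Suc.prems(1) have q0: "q \<noteq> 0" by auto
    have dq: "degree q \<le> n"
      using Suc.prems(2) q0 by (simp add: q degree_mult_eq del: mult_pCons_left)
    define w where "w = A *v v - a *s v"
    show ?thesis
    proof (cases "w = 0")
      case True
      then show ?thesis using Suc.prems by (auto simp: w_def)
    next
      case w0: False
      have pow_w: "((*v) A ^^ k) w = ((*v) A ^^ Suc k) v - a *s ((*v) A ^^ k) v" for k
      proof (induction k)
        case (Suc k)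
        have "((*v) A ^^ Suc k) w = A *v (((*v) A ^^ Suc k) v - a *s ((*v) A ^^ k) v)"
          using Suc by simp
        then show ?case
          by (simp add: matrix_vector_mult_diff_distrib vector_scalar_commute)
      qed (simp add: w_def)
      have cp: "coeff p k = (case k of 0 \<Rightarrow> 0 | Suc i \<Rightarrow> coeff q i) - a * coeff q k" for k
        by (simp add: q coeff_pCons split: nat.split)
      have "(\<Sum>k\<le>n. coeff q k *s ((*v) A ^^ k) w)
          = (\<Sum>k\<le>n. coeff q k *s ((*v) A ^^ Suc k) v) - (\<Sum>k\<le>n. (a * coeff q k) *s ((*v) A ^^ k) v)"
        by (simp add: pow_w vector_ssub_ldistrib sum_subtractf vector_smult_assoc mult.commute)
      also have "(\<Sum>k\<le>n. coeff q k *s ((*v) A ^^ Suc k) v)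
          = (\<Sum>k\<le>Suc n. (case k of 0 \<Rightarrow> 0 | Suc i \<Rightarrow> coeff q i) *s ((*v) A ^^ k) v)"
        by (subst sum.atMost_Suc_shift) simp
      \<comment> \<open>The added summand is zero, because \<open>dq\<close> forces
        \<open>coeff q (Suc n) = 0\<close>.\<close>
      also have "(\<Sum>k\<le>n. (a * coeff q k) *s ((*v) A ^^ k) v) = (\<Sum>k\<le>Suc n. (a * coeff q k) *s ((*v) A ^^ k) v)"
        using dq by (simp add: coeff_eq_0)
      also have "(\<Sum>k\<le>Suc n. (case k of 0 \<Rightarrow> 0 | Suc i \<Rightarrow> coeff q i) *s ((*v) A ^^ k) v)
          - (\<Sum>k\<le>Suc n. (a * coeff q k) *s ((*v) A ^^ k) v) = (\<Sum>k\<le>Suc n. coeff p k *s ((*v) A ^^ k) v)"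
        by (simp only: sum_subtractf[symmetric] cp vector_sub_rdistrib)
      finally show ?thesis
        using Suc.IH[of q w] q0 dq w0 inv[of v a] Suc.prems by (simp add: w_def)
    qed
  qed
qed

text \<open>In finite dimension some iterate of \<open>v\<close> is a real linear combination of the
  earlier ones. Read as a polynomial, this relation is monic and annihilates
  \<open>v\<close>.\<close>

lemma exists_eigenvector_in_invariant:
  fixes A :: "complex^'n^'n"
  assumes inv: "\<And>v a. v \<in> S \<Longrightarrow> A *v v - a *s v \<in> S"
    and v: "v \<in> S" "v \<noteq> 0"
  shows "\<exists>u\<in>S. u \<noteq> 0 \<and> (\<exists>\<mu>. A *v u = \<mu> *s u)"
proof -
  let ?f = "\<lambda>k. ((*v) A ^^ k) v"
  obtain n where "?f n \<in> span (?f ` {..<n})"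
    using exists_mem_span_previous[of ?f] by blast
  then obtain c where c: "?f n = (\<Sum>k<n. c k *\<^sub>R ?f k)"
    using mem_span_image_lessThan by blast
  define p where "p = monom 1 n - (\<Sum>k<n. monom (complex_of_real (c k)) k)"
  have cp: "coeff p k = (if k = n then 1 else if k < n then - of_real (c k) else 0)" for k
    by (simp add: p_def coeff_sum)
  have "coeff p n \<noteq> 0" by (simp add: cp)
  then have "p \<noteq> 0" by auto
  moreover have "degree p \<le> n" by (rule degree_le) (simp add: cp)
  moreover have "(\<Sum>k\<le>n. coeff p k *s ?f k) = 0"
  proof -
    have "(\<Sum>k\<le>n. coeff p k *s ?f k) = (\<Sum>k<n. coeff p k *s ?f k) + ?f n"
      by (simp add: lessThan_Suc_atMost[symmetric] cp)
    also have "(\<Sum>k<n. coeff p k *s ?f k) = - (\<Sum>k<n. c k *\<^sub>R ?f k)"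
      unfolding sum_negf[symmetric]
      by (intro sum.cong) (auto simp: cp vec_eq_iff scaleR_conv_of_real[where 'a = complex])
    finally show ?thesis using c by simp
  qed
  ultimately show ?thesis
    using exists_eigenvector_if_annihilated_by_poly[OF inv] v by blast
qed

text \<open>The spectral theorem, in the form of an expansion with the coefficients
  \<open>cinner w e\<close>.\<close>

lemma normal_eigenvector_expansion:
  fixes A :: "complex^'n^'n"
  assumes A: "A \<in> normal_matrices"
  obtains E m where "finite E" "\<And>e. e \<in> E \<Longrightarrow> e \<noteq> 0" "\<And>e. e \<in> E \<Longrightarrow> A *v e = m e *s e"
    "\<And>w. w = (\<Sum>e\<in>E. cinner w e *s e)"
proof -
  define P where "P E \<longleftrightarrow> (\<forall>e\<in>E. cinner e e = 1 \<and> (\<exists>\<mu>. A *v e = \<mu> *s e)) \<and>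
    (\<forall>e\<in>E. \<forall>e'\<in>E. e \<noteq> e' \<longrightarrow> cinner e e' = 0)" for E
  \<comment> \<open>Hermitian orthogonality implies real orthogonality, so the real dimension bounds
    the cardinality. The bound is crude, but it guarantees that a largest such set exists.\<close>
  have fin: "finite E \<and> card E \<le> DIM(complex^'n)" if "P E" for E
  proof -
    have "pairwise orthogonal E"
      using that by (auto simp: pairwise_def orthogonal_def P_def inner_eq_Re_cinner)
    moreover have "0 \<notin> E" using that by (auto simp: P_def)
    ultimately show ?thesis
      using independent_bound pairwise_orthogonal_independent by blast
  qed
  have "P {}" by (simp add: P_def)
  moreover have "\<forall>E. P E \<longrightarrow> card E < Suc DIM(complex^'n)"
    using fin le_imp_less_Suc by blast
  ultimately have "\<exists>E. P E \<and> (\<forall>E'. P E' \<longrightarrow> card E' \<le> card E)"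
    by (rule ex_has_greatest_nat)
  \<comment> \<open>A maximal orthonormal set of eigenvectors spans: its orthogonal complement is invariant, so it
    would contain another eigenvector.\<close>
  then obtain E where PE: "P E" and max: "\<And>E'. P E' \<Longrightarrow> card E' \<le> card E"
    by blast
  have finE: "finite E" using fin[OF PE] by blast
  obtain m where m: "\<And>e. e \<in> E \<Longrightarrow> A *v e = m e *s e"
    using PE unfolding P_def by metis
  have one: "cinner e e = 1" if "e \<in> E" for e using PE that by (auto simp: P_def)
  have orth: "cinner e e' = 0" if "e \<in> E" "e' \<in> E" "e \<noteq> e'" for e e' using PE that by (auto simp: P_def)
  define S where "S = {v. \<forall>e\<in>E. cinner v e = 0}"
  \<comment> \<open>This is where normality enters: each \<open>e\<close> is also an eigenvector of
    the adjoint, so \<open>A\<close> preserves orthogonality to \<open>e\<close>.\<close>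
  have inv: "A *v v - a *s v \<in> S" if "v \<in> S" for v a
  proof -
    have "cinner (A *v v) e = 0" if "e \<in> E" for e
      using that \<open>v \<in> S\<close> normal_eigenvector_conj_transpose[OF A m[OF that]]
      by (simp add: S_def cinner_conj_transpose cinner_scale_right)
    then show ?thesis
      using \<open>v \<in> S\<close> by (simp add: S_def cinner_diff_left cinner_scale_left)
  qed
  have "w = (\<Sum>e\<in>E. cinner w e *s e)" for w
  proof (rule ccontr)
    assume ne: "w \<noteq> (\<Sum>e\<in>E. cinner w e *s e)"
    define r where "r = w - (\<Sum>e\<in>E. cinner w e *s e)"
    have "cinner r e = 0" if e: "e \<in> E" for e
    proof -
      have "cinner (\<Sum>e\<in>E. cinner w e *s e) e = (\<Sum>e'\<in>E. cinner w e' * cinner e' e)"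
        by (simp add: cinner_sum_left cinner_scale_left)
      also have "\<dots> = (\<Sum>e'\<in>E. if e' = e then cinner w e else 0)"
        by (intro sum.cong) (auto simp: one orth e)
      also have "\<dots> = cinner w e" using finE e by simp
      finally show ?thesis by (simp add: r_def cinner_diff_left)
    qed
    then have "r \<in> S" by (simp add: S_def)
    moreover have "r \<noteq> 0" using ne by (simp add: r_def)
    ultimately obtain u \<mu> where u: "u \<in> S" "u \<noteq> 0" "A *v u = \<mu> *s u"
      using exists_eigenvector_in_invariant[of S A r] inv by blast
    define u' where "u' = complex_of_real (1 / norm u) *s u"
    have "cinner u' u' = 1"
      unfolding u'_def cinner_scale_left cinner_scale_right
      using u(2) by (simp add: cinner_self power2_eq_square)
    moreover have "A *v u' = \<mu> *s u'"
      by (simp add: u'_def vector_scalar_commute u(3) vector_smult_assoc mult.commute)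
    moreover have u'E: "cinner u' e = 0" "cinner e u' = 0" if "e \<in> E" for e
      using u(1) that by (auto simp: u'_def S_def cinner_scale_left cinner_commute[of e])
    ultimately have "P (insert u' E)"
      using PE by (auto simp: P_def)
    then have "card (insert u' E) \<le> card E" by (rule max)
    moreover have "u' \<notin> E" using u'E \<open>cinner u' u' = 1\<close> by auto
    ultimately show False using finE by simp
  qed
  moreover have "e \<noteq> 0" if "e \<in> E" for e using one[OF that] by auto
  ultimately show ?thesis using that finE m by blast
qed

section \<open>Characteristic polynomial, eigenvectors and numerical values\<close>

lemma poly_charpoly:
  "poly (charpoly A) z = det (\<chi> i j. (if i = j then z else 0) - A $ i $ j)"
  unfolding charpoly_def det_def
  by (simp add: poly_sum poly_prod) (intro sum.cong arg_cong2[where f="(*)"] prod.cong refl; simp)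

lemma eigenvalues_with_mult_charpoly_nonzero:
  assumes l: "eigenvalues_with_mult A l"
  shows "charpoly A \<noteq> 0"
proof
  assume 0: "charpoly A = 0"
  \<comment> \<open>\<open>order z 0\<close> is a junk value, but it does not depend on \<open>z\<close>.\<close>
  have const: "order z (0 :: complex poly) = order 0 0" for z by (simp add: order_def)
  \<comment> \<open>A value missed by the finitely many entries of \<open>l\<close> has multiplicity
    0; by \<open>const\<close> every value would then have multiplicity 0, even one that is an
    entry.\<close>
  obtain z where "z \<notin> range (($) l)"
    using ex_new_if_finite[OF infinite_UNIV_char_0, of "range (($) l)"] by auto
  then have "order z (charpoly A) = 0"
    using l unfolding eigenvalues_with_mult_def by (metis (mono_tags, lifting) card.empty empty_Collect_eq rangeI)
  then have "card {i. l $ i = l $ undefined} = 0"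
    using l const unfolding eigenvalues_with_mult_def 0 by metis
  then show False by auto
qed

lemma eigenvalues_with_mult_iff:
  fixes A :: "complex^'n^'n"
  assumes l: "eigenvalues_with_mult A l"
  shows "(\<exists>i. l $ i = z) \<longleftrightarrow> (\<exists>v. v \<noteq> 0 \<and> A *v v = z *s v)"
proof -
  let ?B = "(\<chi> i j. (if i = j then z else 0) - A $ i $ j) :: complex^'n^'n"
  have B: "?B *v v = z *s v - A *v v" for v
    by (simp add: vec_eq_iff matrix_vector_mult_def left_diff_distrib sum_subtractf if_distrib[of "\<lambda>x. x * _"] cong: if_cong)
  have "(\<exists>i. l $ i = z) \<longleftrightarrow> card {i. l $ i = z} \<noteq> 0" by auto
  also have "\<dots> \<longleftrightarrow> poly (charpoly A) z = 0"
    using l eigenvalues_with_mult_charpoly_nonzero[OF l] by (simp add: eigenvalues_with_mult_def order_root)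
  also have "\<dots> \<longleftrightarrow> \<not> invertible ?B"
    by (simp add: poly_charpoly invertible_det_nz)
  also have "\<dots> \<longleftrightarrow> (\<exists>v. v \<noteq> 0 \<and> ?B *v v = 0)"
    by (simp add: invertible_left_inverse matrix_left_invertible_ker) blast
  finally show ?thesis by (auto simp: B)
qed

text \<open>In an eigenbasis, \<open>cinner (B *v w) w\<close> is a mean of the eigenvalues with
  weights \<open>c e\<close> of sum 1. Eigenvalues close to \<open>z'\<close> cost at most
  \<open>\<eta>\<close>; the others are at distance at least \<open>\<delta>\<close> from
  \<open>z\<close>, so their weight is paid for by the residual of \<open>w\<close>. In the
  application, \<open>z\<close> is an unperturbed eigenvalue and \<open>z'\<close> its first-order
  prediction.\<close>

lemma normal_numerical_value_estimate:
  fixes B :: "complex^'n^'n"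
  assumes B: "B \<in> normal_matrices"
    and spec: "\<And>\<mu> v. v \<noteq> 0 \<Longrightarrow> B *v v = \<mu> *s v \<Longrightarrow> cmod (\<mu> - z') \<le> \<eta> \<or> \<delta> \<le> cmod (\<mu> - z)"
    and "\<delta> > 0" "\<eta> \<ge> 0" and w: "norm w = 1"
  shows "cmod (cinner (B *v w) w - z') \<le> \<eta> + (1 + cmod (z - z') / \<delta>) / \<delta> * (norm (B *v w - z *s w))\<^sup>2"
proof -
  obtain E m where E: "finite E" "\<And>e. e \<in> E \<Longrightarrow> e \<noteq> 0" "\<And>e. e \<in> E \<Longrightarrow> B *v e = m e *s e"
    "\<And>w. w = (\<Sum>e\<in>E. cinner w e *s e)"
    using normal_eigenvector_expansion[OF B] by blast
  define c where "c e = (cmod (cinner w e))\<^sup>2" for e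
  \<comment> \<open>For an eigenvalue at distance \<open>x\<close> from \<open>z\<close> with
    \<open>1 \<le> x / \<delta>\<close>, the bound \<open>x + cmod (z - z')\<close> is at most
    \<open>x * (x / \<delta>) + cmod (z - z') * (x / \<delta>)\<^sup>2\<close>, which is
    \<open>K * x\<^sup>2\<close>.\<close>
  define K where "K = (1 + cmod (z - z') / \<delta>) / \<delta>"
  have parseval: "cinner v u = (\<Sum>e\<in>E. cinner v e * cnj (cinner u e))" for u v
  proof -
    have "cinner v u = cinner v (\<Sum>e\<in>E. cinner u e *s e)" using E(4)[of u] by simp
    also have "\<dots> = (\<Sum>e\<in>E. cinner v e * cnj (cinner u e))"
      by (simp add: cinner_sum_right cinner_scale_right mult.commute)
    finally show ?thesis .
  qed
  have Bw: "cinner (B *v w) e = m e * cinner w e" if "e \<in> E" for e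
    by (simp add: cinner_conj_transpose normal_eigenvector_conj_transpose[OF B E(3)[OF that]] cinner_scale_right)
  have c1: "(\<Sum>e\<in>E. complex_of_real (c e)) = 1"
    using parseval[of w w] w by (simp add: cinner_self c_def complex_norm_square del: of_real_power of_real_sum)
  have "cinner (B *v w) w = (\<Sum>e\<in>E. m e * complex_of_real (c e))"
    unfolding parseval[of "B *v w" w] c_def complex_norm_square
    by (intro sum.cong) (auto simp: Bw mult.assoc)
  moreover have "z' = (\<Sum>e\<in>E. z' * complex_of_real (c e))"
    by (simp add: sum_distrib_left[symmetric] c1)
  ultimately have "cinner (B *v w) w - z' = (\<Sum>e\<in>E. (m e - z') * complex_of_real (c e))"
    by (simp add: left_diff_distrib sum_subtractf)
  then have "cmod (cinner (B *v w) w - z') \<le> (\<Sum>e\<in>E. cmod (m e - z') * c e)"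
    by (auto intro!: sum_norm_le simp: norm_mult c_def simp del: of_real_power)
  also have "\<dots> \<le> (\<Sum>e\<in>E. \<eta> * c e + K * ((cmod (m e - z))\<^sup>2 * c e))"
  proof (rule sum_mono)
    fix e assume e: "e \<in> E"
    have c0: "c e \<ge> 0" by (simp add: c_def)
    have K0: "K \<ge> 0" using \<open>\<delta> > 0\<close> by (simp add: K_def)
    have "cmod (m e - z') \<le> \<eta> + K * (cmod (m e - z))\<^sup>2"
      using spec[OF E(2,3)[OF e]]
    proof
      assume "cmod (m e - z') \<le> \<eta>"
      moreover have "K * (cmod (m e - z))\<^sup>2 \<ge> 0" using K0 by simp
      ultimately show ?thesis by linarith
    next
      let ?x = "cmod (m e - z)"
      assume d: "\<delta> \<le> ?x"
      have "cmod (m e - z') \<le> ?x + cmod (z - z')"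
        using norm_triangle_ineq[of "m e - z" "z - z'"] by simp
      also have "\<dots> \<le> ?x * (?x / \<delta>) + cmod (z - z') * (?x / \<delta>)\<^sup>2"
      proof (intro add_mono)
        have 1: "1 \<le> ?x / \<delta>" using d \<open>\<delta> > 0\<close> by simp
        then show "?x \<le> ?x * (?x / \<delta>)" using mult_left_mono[OF 1, of ?x] by simp
        show "cmod (z - z') \<le> cmod (z - z') * (?x / \<delta>)\<^sup>2"
          using mult_left_mono[OF one_le_power[OF 1, of 2], of "cmod (z - z')"] by simp
      qed
      also have "\<dots> = K * ?x\<^sup>2"
        using \<open>\<delta> > 0\<close> by (simp add: K_def power2_eq_square field_simps)
      finally show ?thesis using \<open>\<eta> \<ge> 0\<close> by simp
    qed
    from mult_right_mono[OF this c0] show "cmod (m e - z') * c e \<le> \<eta> * c e + K * ((cmod (m e - z))\<^sup>2 * c e)"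
      by (simp add: algebra_simps)
  qed
  also have "\<dots> = \<eta> * (\<Sum>e\<in>E. c e) + K * (\<Sum>e\<in>E. (cmod (m e - z))\<^sup>2 * c e)"
    by (simp add: sum.distrib sum_distrib_left)
  also have "(\<Sum>e\<in>E. c e) = 1"
    using c1 by (metis of_real_eq_1_iff of_real_sum)
  also have "(\<Sum>e\<in>E. (cmod (m e - z))\<^sup>2 * c e) = (norm (B *v w - z *s w))\<^sup>2"
  proof -
    have "complex_of_real ((norm (B *v w - z *s w))\<^sup>2) = cinner (B *v w - z *s w) (B *v w - z *s w)"
      by (simp add: cinner_self)
    also have "\<dots> = (\<Sum>e\<in>E. complex_of_real ((cmod (m e - z))\<^sup>2 * c e))"
      unfolding parseval[of "B *v w - z *s w" "B *v w - z *s w"]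
    proof (rule sum.cong)
      fix e assume e: "e \<in> E"
      have "cinner (B *v w - z *s w) e = (m e - z) * cinner w e"
        by (simp add: cinner_diff_left cinner_scale_left Bw[OF e] left_diff_distrib)
      then show "cinner (B *v w - z *s w) e * cnj (cinner (B *v w - z *s w) e) = complex_of_real ((cmod (m e - z))\<^sup>2 * c e)"
        by (simp only: complex_norm_square[symmetric] c_def norm_mult power_mult_distrib)
    qed simp
    finally show ?thesis unfolding of_real_sum[symmetric] of_real_eq_iff by simp
  qed
  finally show ?thesis by (simp add: K_def)
qed

section \<open>Derivatives of eigenvalues\<close>

lemma has_vector_derivative_quotient:
  assumes "(f has_vector_derivative D) (at 0)"
  shows "((\<lambda>s. (f s - f 0) /\<^sub>R s) \<longlongrightarrow> D) (at 0)"
proof -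
  have "((\<lambda>s. norm (f s - f 0 - s *\<^sub>R D) / \<bar>s\<bar>) \<longlongrightarrow> 0) (at 0)"
    using assms by (simp add: has_vector_derivative_def has_derivative_at)
  moreover have "norm (f s - f 0 - s *\<^sub>R D) / \<bar>s\<bar> = norm ((f s - f 0) /\<^sub>R s - D)" if "s \<noteq> 0" for s
  proof -
    have "(f s - f 0) /\<^sub>R s - D = (f s - f 0 - s *\<^sub>R D) /\<^sub>R s"
      using that by (simp add: scaleR_diff_right)
    then show ?thesis by (simp add: divide_inverse mult.commute)
  qed
  ultimately have "((\<lambda>s. norm ((f s - f 0) /\<^sub>R s - D)) \<longlongrightarrow> 0) (at 0)"
    by (elim Lim_transform_eventually) (auto simp: eventually_at_filter)
  then show ?thesis
    by (simp add: tendsto_norm_zero_iff LIM_zero_iff)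
qed

lemma norm_vector_derivative_le:
  assumes f: "(f has_vector_derivative D) (at 0)"
    and bound: "\<forall>\<^sub>F s in at 0. norm (f s - f 0) \<le> K * \<bar>s\<bar>"
  shows "norm D \<le> K"
proof (rule tendsto_upperbound[OF tendsto_norm[OF has_vector_derivative_quotient[OF f]]])
  have "\<forall>\<^sub>F s in at 0. s \<noteq> (0::real)" by (simp add: eventually_at_filter)
  with bound show "\<forall>\<^sub>F s in at 0. norm ((f s - f 0) /\<^sub>R s) \<le> K"
  proof eventually_elim
    case (elim s)
    then have "norm ((f s - f 0) /\<^sub>R s) = norm (f s - f 0) / \<bar>s\<bar>"
      by (simp add: divide_inverse mult.commute)
    also have "\<dots> \<le> K" using elim by (simp add: pos_divide_le_eq)
    finally show ?case .
  qed
qed simp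

lemma scaleR_matrix_vector_mult:
  fixes A :: "complex^'n^'m"
  shows "(r *\<^sub>R A) *v v = r *\<^sub>R (A *v v)"
  by (simp add: vec_eq_iff matrix_vector_mult_def scaleR_right.sum)

lemma unit_vectors_convergent_subseq:
  fixes V :: "nat \<Rightarrow> complex^'n"
  assumes "\<And>k. norm (V k) = 1"
  obtains r v where "strict_mono r" "(V \<circ> r) \<longlonglongrightarrow> v" "norm v = 1"
proof -
  have "seq_compact (sphere (0 :: complex^'n) 1)"
    by (simp add: compact_imp_seq_compact)
  then show ?thesis
    using assms that by (auto elim!: seq_compactE[where f = V])
qed

lemma eigenvalues_with_mult_unit_eigenvector:
  assumes "eigenvalues_with_mult A l"
  shows "\<exists>v. norm v = 1 \<and> A *v v = l $ i *s v"
proof -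
  obtain v where v: "v \<noteq> 0" "A *v v = l $ i *s v"
    using eigenvalues_with_mult_iff[OF assms, of "l $ i"] by blast
  let ?c = "complex_of_real (1 / norm v)"
  have "?c *s v = (1 / norm v) *\<^sub>R v"
    by (simp add: vec_eq_iff scaleR_conv_of_real[where 'a = complex])
  then have "norm (?c *s v) = 1" using v by simp
  moreover have "A *v (?c *s v) = l $ i *s (?c *s v)"
    by (simp only: vector_scalar_commute v(2) vector_smult_assoc mult.commute)
  ultimately show ?thesis by blast
qed

text \<open>Unit eigenvectors at parameters tending to 0 accumulate at some \<open>v\<close>. The
  difference quotient of \<open>B\<close>, applied to them, is paired with the limit
  \<open>v\<close>: since \<open>B 0\<close> is normal, its adjoint acts on \<open>v\<close> as a
  scalar, and the quotient of \<open>\<mu>\<close> appears. The eigenvectors need not be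
  differentiable.\<close>

lemma eigenvalue_derivative_eq_cinner:
  fixes B :: "real \<Rightarrow> complex^'d^'d" and \<mu> :: "real \<Rightarrow> complex"
  assumes ev: "\<forall>\<^sub>F s in at 0. \<exists>v. norm v = 1 \<and> B s *v v = \<mu> s *s v"
    and normal: "B 0 \<in> normal_matrices"
    and B: "(B has_vector_derivative B') (at 0)"
    and \<mu>: "(\<mu> has_vector_derivative \<mu>') (at 0)"
  shows "\<exists>v. norm v = 1 \<and> B 0 *v v = \<mu> 0 *s v \<and> cinner (B' *v v) v = \<mu>'"
proof -
  obtain v0 :: "complex^'d" where "norm v0 = 1"
    using vector_choose_size[of 1] by auto
  \<comment> \<open>The implication allows a choice at every \<open>s\<close>, with the unit vector
    \<open>v0\<close> as default where no eigenvector is available.\<close>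
  then have "\<exists>v. norm v = 1 \<and> ((\<exists>u. norm u = 1 \<and> B s *v u = \<mu> s *s u) \<longrightarrow> B s *v v = \<mu> s *s v)" for s
    by metis
  then obtain W where W: "\<And>s. norm (W s) = 1"
    "\<And>s. \<exists>u. norm u = 1 \<and> B s *v u = \<mu> s *s u \<Longrightarrow> B s *v W s = \<mu> s *s W s"
    by metis
  have ev: "\<forall>\<^sub>F s in at 0. B s *v W s = \<mu> s *s W s"
    using ev by eventually_elim (rule W(2))
  define X where "X k = 1 / real (Suc k)" for k
  obtain r v where r: "strict_mono r" "((\<lambda>k. W (X k)) \<circ> r) \<longlonglongrightarrow> v" and v: "norm v = 1"
    using unit_vectors_convergent_subseq[of "\<lambda>k. W (X k)"] W(1) by blast
  define s where "s k = X (r k)" for k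
  have "X \<longlonglongrightarrow> 0"
    unfolding X_def using LIMSEQ_inverse_real_of_nat by (simp add: inverse_eq_divide)
  then have "s \<longlonglongrightarrow> 0"
    using LIMSEQ_subseq_LIMSEQ[OF _ r(1)] by (simp add: s_def[abs_def] o_def)
  then have s: "filterlim s (at 0) sequentially"
    by (auto simp: filterlim_at s_def X_def)
  have Wv: "(\<lambda>k. W (s k)) \<longlonglongrightarrow> v"
    using r(2) by (simp add: s_def o_def)
  have evs: "\<forall>\<^sub>F k in sequentially. B (s k) *v W (s k) = \<mu> (s k) *s W (s k)"
    using s ev by (auto simp: filterlim_iff)
  have "(B \<longlongrightarrow> B 0) (at 0)" "(\<mu> \<longlongrightarrow> \<mu> 0) (at 0)"
    using has_vector_derivative_continuous[OF B] has_vector_derivative_continuous[OF \<mu>]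
    by (simp_all add: continuous_at)
  then have Bs: "(\<lambda>k. B (s k)) \<longlonglongrightarrow> B 0" and \<mu>s: "(\<lambda>k. \<mu> (s k)) \<longlonglongrightarrow> \<mu> 0"
    using s by (auto intro: filterlim_compose)
  have "(\<lambda>k. B (s k) *v W (s k)) \<longlonglongrightarrow> B 0 *v v" "(\<lambda>k. \<mu> (s k) *s W (s k)) \<longlonglongrightarrow> \<mu> 0 *s v"
    by (intro tendsto_intros Bs \<mu>s Wv)+
  from Lim_transform_eventually[OF this(1) evs] this(2) have eig: "B 0 *v v = \<mu> 0 *s v"
    by (rule LIMSEQ_unique)
  have Q1: "(\<lambda>k. (B (s k) - B 0) /\<^sub>R s k) \<longlonglongrightarrow> B'"
    and Q2: "(\<lambda>k. (\<mu> (s k) - \<mu> 0) /\<^sub>R s k) \<longlonglongrightarrow> \<mu>'"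
    using filterlim_compose[OF has_vector_derivative_quotient[OF B] s]
      filterlim_compose[OF has_vector_derivative_quotient[OF \<mu>] s] by auto
  have lim1: "(\<lambda>k. cinner (((B (s k) - B 0) /\<^sub>R s k) *v W (s k)) v) \<longlonglongrightarrow> cinner (B' *v v) v"
    by (intro tendsto_cinner tendsto_matrix_vector_mult Q1 Wv tendsto_const)
  have lim2: "(\<lambda>k. (\<mu> (s k) - \<mu> 0) /\<^sub>R s k * cinner (W (s k)) v) \<longlonglongrightarrow> \<mu>' * cinner v v"
    by (intro tendsto_mult tendsto_cinner Q2 Wv tendsto_const)
  have "\<forall>\<^sub>F k in sequentially. cinner (((B (s k) - B 0) /\<^sub>R s k) *v W (s k)) v
      = (\<mu> (s k) - \<mu> 0) /\<^sub>R s k * cinner (W (s k)) v"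
    using evs
  proof eventually_elim
    case (elim k)
    have "cinner (B 0 *v W (s k)) v = \<mu> 0 * cinner (W (s k)) v"
      by (simp add: cinner_conj_transpose normal_eigenvector_conj_transpose[OF normal eig] cinner_scale_right)
    moreover have "((B (s k) - B 0) /\<^sub>R s k) *v W (s k) = (B (s k) *v W (s k) - B 0 *v W (s k)) /\<^sub>R s k"
      by (simp add: scaleR_matrix_vector_mult matrix_vector_mult_diff_rdistrib)
    ultimately show ?case
      by (simp add: cinner_scaleR_left cinner_diff_left elim cinner_scale_left scaleR_conv_of_real[where 'a = complex] left_diff_distrib right_diff_distrib mult.assoc)
  qed
  from LIMSEQ_unique[OF Lim_transform_eventually[OF lim1 this] lim2]
  have "cinner (B' *v v) v = \<mu>'" by (simp add: cinner_self v)
  with eig v show ?thesis by blast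
qed

text \<open>By \<open>same\<close>, every eigenvalue branch through \<open>z\<close> stays within
  \<open>\<epsilon> * \<bar>s\<bar>\<close> of \<open>z + s *\<^sub>R c\<close>, while the others
  keep away from \<open>z\<close>. The residual \<open>B s *v w - z *s w\<close> is of order
  \<open>s\<close>; its square remains negligible after division by \<open>s\<close>, so the
  numerical value at \<open>w\<close> has derivative \<open>c\<close>.\<close>

lemma eigenvalue_derivative_constant_on_eigenspace:
  fixes B :: "real \<Rightarrow> complex^'d^'d" and l :: "real \<Rightarrow> complex^'d"
  assumes ev: "\<forall>\<^sub>F s in at 0. B s \<in> normal_matrices \<and> eigenvalues_with_mult (B s) (l s)"
    and B: "(B has_vector_derivative B') (at 0)"
    and l: "(l has_vector_derivative l') (at 0)"
    and same: "\<And>k. l 0 $ k = z \<Longrightarrow> l' $ k = c"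
    and w: "norm w = 1" "B 0 *v w = z *s w"
  shows "cinner (B' *v w) w = c"
proof -
  define D where "D s = (B s - B 0) /\<^sub>R s" for s
  have D: "(D \<longlongrightarrow> B') (at 0)"
    unfolding D_def by (rule has_vector_derivative_quotient[OF B])
  \<comment> \<open>Half the gap between \<open>z\<close> and the other eigenvalues, so that nearby
    branches keep the distance \<open>\<delta>\<close>. The inserted 1 covers the case that there
    are no others.\<close>
  define \<delta> where "\<delta> = Min (insert 1 ((\<lambda>k. cmod (l 0 $ k - z) / 2) ` {k. l 0 $ k \<noteq> z}))"
  have \<delta>0: "\<delta> > 0" by (auto simp: \<delta>_def)
  have \<delta>_le: "\<delta> \<le> cmod (l 0 $ k - z) / 2" if "l 0 $ k \<noteq> z" for k
    unfolding \<delta>_def using that by (intro Min_le) auto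
  have "cmod (cinner (B' *v w) w - c) \<le> \<epsilon>" if \<epsilon>: "\<epsilon> > 0" for \<epsilon>
  proof -
    have near: "\<forall>\<^sub>F s in at 0. l 0 $ k = z \<longrightarrow> cmod (l s $ k - (z + s *\<^sub>R c)) \<le> \<epsilon> * \<bar>s\<bar>" for k
    proof (cases "l 0 $ k = z")
      case True
      have "((\<lambda>s. ((l s - l 0) /\<^sub>R s) $ k) \<longlongrightarrow> l' $ k) (at 0)"
        by (intro tendsto_vec_nth has_vector_derivative_quotient[OF l])
      from tendstoD[OF this \<epsilon>] have "\<forall>\<^sub>F s in at 0. dist (((l s - l 0) /\<^sub>R s) $ k) c < \<epsilon>"
        using same[OF True] by simp
      moreover have "\<forall>\<^sub>F s in at 0. s \<noteq> (0::real)" by (simp add: eventually_at_filter)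
      ultimately show ?thesis
      proof eventually_elim
        case (elim s)
        have "l s $ k - (z + s *\<^sub>R c) = s *\<^sub>R (((l s - l 0) /\<^sub>R s) $ k - c)"
          using elim(2) True by (simp add: scaleR_diff_right)
        then have "cmod (l s $ k - (z + s *\<^sub>R c)) = \<bar>s\<bar> * cmod (((l s - l 0) /\<^sub>R s) $ k - c)"
          by (simp only: norm_scaleR)
        also have "\<dots> \<le> \<bar>s\<bar> * \<epsilon>"
          using elim(1) by (intro mult_left_mono) (auto simp: dist_norm)
        finally show ?case by (simp add: mult.commute)
      qed
    qed simp
    have far: "\<forall>\<^sub>F s in at 0. l 0 $ k \<noteq> z \<longrightarrow> \<delta> \<le> cmod (l s $ k - z)" for k
    proof (cases "l 0 $ k = z")
      case False
      have "(l \<longlongrightarrow> l 0) (at 0)"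
        using has_vector_derivative_continuous[OF l] by (simp add: continuous_at)
      then have "((\<lambda>s. cmod (l s $ k - z)) \<longlongrightarrow> cmod (l 0 $ k - z)) (at 0)"
        by (intro tendsto_intros)
      moreover have "cmod (l 0 $ k - z) / 2 < cmod (l 0 $ k - z)" using False by simp
      ultimately have "\<forall>\<^sub>F s in at 0. cmod (l 0 $ k - z) / 2 < cmod (l s $ k - z)"
        by (rule order_tendstoD(1))
      then show ?thesis
        by eventually_elim (use \<delta>_le[of k] in auto)
    qed simp
    have "\<forall>\<^sub>F s in at 0. \<forall>k. (l 0 $ k = z \<longrightarrow> cmod (l s $ k - (z + s *\<^sub>R c)) \<le> \<epsilon> * \<bar>s\<bar>) \<and>
        (l 0 $ k \<noteq> z \<longrightarrow> \<delta> \<le> cmod (l s $ k - z))"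
      by (intro eventually_all_finite eventually_conj near far)
    moreover have "\<forall>\<^sub>F s in at 0. s \<noteq> (0::real)" by (simp add: eventually_at_filter)
    ultimately have "\<forall>\<^sub>F s in at 0. cmod (cinner (D s *v w) w - c)
        \<le> \<epsilon> + (1 + \<bar>s\<bar> * cmod c / \<delta>) / \<delta> * (\<bar>s\<bar> * (norm (D s *v w))\<^sup>2)"
      using ev
    proof eventually_elim
      case (elim s)
      have Dw: "s *\<^sub>R (D s *v w) = B s *v w - z *s w"
        using elim(2) by (simp add: D_def scaleR_matrix_vector_mult matrix_vector_mult_diff_rdistrib w(2))
      have "cmod (cinner (B s *v w) w - (z + s *\<^sub>R c))
          \<le> \<epsilon> * \<bar>s\<bar> + (1 + cmod (z - (z + s *\<^sub>R c)) / \<delta>) / \<delta> * (norm (B s *v w - z *s w))\<^sup>2"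
      proof (rule normal_numerical_value_estimate)
        fix \<mu> v assume "v \<noteq> 0" "B s *v v = \<mu> *s v"
        then obtain k where "l s $ k = \<mu>"
          using eigenvalues_with_mult_iff elim(3) by blast
        with elim(1) show "cmod (\<mu> - (z + s *\<^sub>R c)) \<le> \<epsilon> * \<bar>s\<bar> \<or> \<delta> \<le> cmod (\<mu> - z)"
          by blast
      qed (use elim \<delta>0 \<epsilon> w in auto)
      also have "cinner (B s *v w) w - (z + s *\<^sub>R c) = s *\<^sub>R (cinner (D s *v w) w - c)"
      proof -
        have "cinner (B s *v w) w = cinner (s *\<^sub>R (D s *v w) + z *s w) w" by (simp add: Dw)
        also have "\<dots> = s *\<^sub>R cinner (D s *v w) w + z"
          by (simp add: cinner_add_left cinner_scaleR_left cinner_scale_left cinner_self w scaleR_conv_of_real[where 'a = complex])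
        finally show ?thesis by (simp add: scaleR_diff_right)
      qed
      finally have "\<bar>s\<bar> * cmod (cinner (D s *v w) w - c)
          \<le> \<epsilon> * \<bar>s\<bar> + (1 + \<bar>s\<bar> * cmod c / \<delta>) / \<delta> * (\<bar>s\<bar> * norm (D s *v w))\<^sup>2"
        by (simp add: Dw[symmetric])
      also have "\<dots> = \<bar>s\<bar> * (\<epsilon> + (1 + \<bar>s\<bar> * cmod c / \<delta>) / \<delta> * (\<bar>s\<bar> * (norm (D s *v w))\<^sup>2))"
        by (simp add: power_mult_distrib power2_eq_square algebra_simps)
      finally show ?case using elim(2) by simp
    qed
    moreover have "((\<lambda>s. cmod (cinner (D s *v w) w - c)) \<longlongrightarrow> cmod (cinner (B' *v w) w - c)) (at 0)"
      by (intro tendsto_intros D)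
    moreover have "((\<lambda>s. \<epsilon> + (1 + \<bar>s\<bar> * cmod c / \<delta>) / \<delta> * (\<bar>s\<bar> * (norm (D s *v w))\<^sup>2)) \<longlongrightarrow>
        \<epsilon> + (1 + \<bar>0\<bar> * cmod c / \<delta>) / \<delta> * (\<bar>0\<bar> * (norm (B' *v w))\<^sup>2)) (at 0)"
      using \<delta>0 by (intro tendsto_intros D) auto
    ultimately show ?thesis
      using tendsto_le[of "at (0::real)"] by fastforce
  qed
  then show ?thesis
    by (metis dense_ge norm_le_zero_iff right_minus_eq)
qed

text \<open>The unit vectors themselves may fail to converge. Yet a subsequence of
  \<open>\<nu>\<close> staying away from \<open>c\<close> would have a further subsequence along
  which they tend to some eigenvector of \<open>B0\<close>, and there \<open>const\<close> forces
  the limit \<open>c\<close>.\<close>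

lemma tendsto_cinner_on_eigenvectors:
  fixes B :: "nat \<Rightarrow> complex^'d^'d"
  assumes "B \<longlonglongrightarrow> B0" "B' \<longlonglongrightarrow> B0'" "\<mu> \<longlonglongrightarrow> \<mu>0"
    and v: "\<And>n. \<exists>v. norm v = 1 \<and> B n *v v = \<mu> n *s v \<and> cinner (B' n *v v) v = \<nu> n"
    and const: "\<And>w. norm w = 1 \<Longrightarrow> B0 *v w = \<mu>0 *s w \<Longrightarrow> cinner (B0' *v w) w = c"
  shows "\<nu> \<longlonglongrightarrow> c"
proof (rule ccontr)
  assume "\<not> ?thesis"
  then obtain e where "e > 0" "\<not> (\<exists>N. \<forall>n\<ge>N. dist (\<nu> n) c < e)"
    by (auto simp: lim_sequentially)
  then have "infinite {n. e \<le> dist (\<nu> n) c}"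
    by (auto simp: infinite_nat_iff_unbounded_le not_less)
  then obtain r :: "nat \<Rightarrow> nat" where r: "strict_mono r" "\<And>n. e \<le> dist (\<nu> (r n)) c"
    using infinite_enumerate by (metis (mono_tags, lifting) mem_Collect_eq)
  obtain V where V: "\<And>n. norm (V n) = 1" "\<And>n. B n *v V n = \<mu> n *s V n" "\<And>n. cinner (B' n *v V n) (V n) = \<nu> n"
    using v by metis
  obtain q w where q: "strict_mono q" "((\<lambda>n. V (r n)) \<circ> q) \<longlonglongrightarrow> w" and w: "norm w = 1"
    using unit_vectors_convergent_subseq[of "\<lambda>n. V (r n)"] V(1) by blast
  define p where "p = r \<circ> q"
  have p: "strict_mono p" unfolding p_def by (rule strict_mono_o[OF r(1) q(1)])
  have Vw: "(\<lambda>n. V (p n)) \<longlonglongrightarrow> w" using q(2) by (simp add: p_def o_def)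
  have lims: "(\<lambda>n. B (p n)) \<longlonglongrightarrow> B0" "(\<lambda>n. B' (p n)) \<longlonglongrightarrow> B0'" "(\<lambda>n. \<mu> (p n)) \<longlonglongrightarrow> \<mu>0"
    using assms(1-3)[THEN LIMSEQ_subseq_LIMSEQ[OF _ p]] by (simp_all add: o_def)
  have "(\<lambda>n. B (p n) *v V (p n)) \<longlonglongrightarrow> B0 *v w" "(\<lambda>n. \<mu> (p n) *s V (p n)) \<longlonglongrightarrow> \<mu>0 *s w"
    by (intro tendsto_intros lims Vw)+
  then have "B0 *v w = \<mu>0 *s w"
    unfolding V(2) by (rule LIMSEQ_unique)
  then have "cinner (B0' *v w) w = c" by (rule const[OF w])
  moreover have "(\<lambda>n. cinner (B' (p n) *v V (p n)) (V (p n))) \<longlonglongrightarrow> cinner (B0' *v w) w"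
    by (intro tendsto_intros lims Vw)
  ultimately have "(\<lambda>n. \<nu> (p n)) \<longlonglongrightarrow> c" by (simp add: V(3))
  then obtain n where "dist (\<nu> (p n)) c < e"
    using \<open>e > 0\<close> by (meson LIMSEQ_le_const metric_LIMSEQ_D order_refl)
  with r(2)[of "q n"] show False by (simp add: p_def)
qed

section \<open>Convergence of the partial derivatives\<close>

lemma C01_norm_leD:
  assumes f: "C01_norm U f \<le> ennreal K" and K: "K \<ge> 0"
  shows "x \<in> U \<Longrightarrow> norm (f x) \<le> K" and "K-lipschitz_on U f"
proof -
  let ?Q = "{(x, y). x \<in> U \<and> y \<in> U \<and> x \<noteq> y}"
  have a: "(SUP x\<in>U. ennreal (norm (f x))) \<le> ennreal K"
    and b: "(SUP (x, y)\<in>?Q. ennreal (norm (f x - f y) / norm (x - y))) \<le> ennreal K"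
    by (rule order_trans[OF _ f[unfolded C01_norm_def]], simp add: add_increasing add_increasing2)+
  show "norm (f x) \<le> K" if "x \<in> U" for x
    using SUP_upper[OF that, of "\<lambda>x. ennreal (norm (f x))"] a K by (meson ennreal_le_iff order_trans)
  show "K-lipschitz_on U f"
  proof (rule lipschitz_onI[OF _ K])
    fix x y assume xy: "x \<in> U" "y \<in> U"
    show "dist (f x) (f y) \<le> K * dist x y"
    proof (cases "x = y")
      case False
      then have "(x, y) \<in> ?Q" using xy by simp
      from SUP_upper[OF this, of "\<lambda>(x, y). ennreal (norm (f x - f y) / norm (x - y))"]
      have "ennreal (norm (f x - f y) / norm (x - y)) \<le> ennreal K"
        using b by (auto intro: order_trans)
      then have "norm (f x - f y) / norm (x - y) \<le> K" using K by simp
      then show ?thesis using False by (simp add: dist_norm pos_divide_le_eq)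
    qed simp
  qed
qed

lemma C01_lipschitz:
  assumes "f \<in> C01 U"
  obtains K where "K-lipschitz_on U f"
proof -
  have "C01_norm U f < \<infinity>" using assms by (simp add: C01_def)
  then obtain K where "C01_norm U f = ennreal K" "K \<ge> 0" by (cases "C01_norm U f") auto
  then show ?thesis using C01_norm_leD(2)[of U f K] that by simp
qed

lemma partially_differentiable_has_vector_derivative:
  assumes "partially_differentiable j f x"
  shows "((\<lambda>t. f (x + t *\<^sub>R axis j 1)) has_vector_derivative partial_deriv j f x) (at 0)"
  using assms unfolding partially_differentiable_def partial_deriv_def by (simp add: vector_derivative_works)

lemma eventually_mem_open_axis:
  fixes x :: "real^'m"
  assumes "open U" "x \<in> U"
  shows "\<forall>\<^sub>F t in nhds 0. x + t *\<^sub>R axis j 1 \<in> U"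
proof -
  have "((\<lambda>t. x + t *\<^sub>R axis j 1) \<longlongrightarrow> x + 0 *\<^sub>R axis j 1) (nhds (0::real))"
    by (intro tendsto_intros filterlim_ident)
  then show ?thesis using assms by (intro topological_tendstoD) auto
qed

text \<open>Carries derivatives of an extension back to the original function on the open set
  \<open>U\<close>.\<close>

lemma has_vector_derivative_axis_cong:
  fixes x :: "real^'m"
  assumes U: "open U" "x \<in> U" and eq: "\<And>y. y \<in> U \<Longrightarrow> g y = f y"
    and g: "((\<lambda>t. g (x + t *\<^sub>R axis j 1)) has_vector_derivative D) (at 0)"
  shows "((\<lambda>t. f (x + t *\<^sub>R axis j 1)) has_vector_derivative D) (at 0)"
proof -
  obtain T where T: "open T" "0 \<in> T" "\<And>t. t \<in> T \<Longrightarrow> x + t *\<^sub>R axis j 1 \<in> U"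
    using eventually_mem_open_axis[OF U, of j] unfolding eventually_nhds by blast
  show ?thesis
    by (rule has_vector_derivative_transform_within_open[OF g T(1,2)]) (use T(3) eq in auto)
qed

lemma AE_partially_differentiable_C01:
  fixes f :: "real^'m \<Rightarrow> 'b::euclidean_space"
  assumes "open U" "f \<in> C01 U"
  shows "AE x in lborel. x \<in> U \<longrightarrow> partially_differentiable j f x"
proof -
  obtain L where "L-lipschitz_on U f" using C01_lipschitz[OF assms(2)] .
  then obtain K g where g: "K-lipschitz_on UNIV g" "\<And>x. x \<in> U \<Longrightarrow> g x = f x"
    using lipschitz_extension by blast
  show ?thesis
    using AE_partially_differentiable[OF g(1), of j]
  proof eventually_elim
    case (elim x)
    show ?case
    proof
      assume "x \<in> U"
      from has_vector_derivative_axis_cong[OF assms(1) this g(2) partially_differentiable_has_vector_derivative[OF elim]]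
      show "partially_differentiable j f x"
        unfolding partially_differentiable_def by (rule differentiableI_vector)
    qed
  qed
qed

lemma AE_equal_components_imp_equal_partial_derivs:
  fixes f :: "real^'m \<Rightarrow> complex^'d"
  assumes "open U" "f \<in> C01 U"
  shows "AE x in lborel. x \<in> U \<longrightarrow>
    (\<forall>i k. f x $ i = f x $ k \<longrightarrow> partial_deriv j f x $ i = partial_deriv j f x $ k)"
proof -
  obtain L where "L-lipschitz_on U f" using C01_lipschitz[OF assms(2)] .
  then obtain K g where g: "K-lipschitz_on UNIV g" "\<And>x. x \<in> U \<Longrightarrow> g x = f x"
    using lipschitz_extension by blast
  \<comment> \<open>Differentiability is kept as a premise because \<open>partial_deriv\<close> is
    meaningful only then; it is discharged almost everywhere at the end.\<close>
  have "AE x in lborel. x \<in> U \<and> partially_differentiable j f x \<longrightarrow> f x $ i = f x $ k \<longrightarrow>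
      partial_deriv j f x $ i = partial_deriv j f x $ k" for i k
  proof -
    have "(2 * K)-lipschitz_on UNIV (\<lambda>x. g x $ i - g x $ k)"
    proof (rule lipschitz_onI)
      fix x y :: "real^'m"
      have "dist (g x $ i - g x $ k) (g y $ i - g y $ k) = cmod ((g x - g y) $ i - (g x - g y) $ k)"
        by (simp add: dist_norm algebra_simps)
      also have "\<dots> \<le> norm (g x - g y) + norm (g x - g y)"
        by (intro order_trans[OF norm_triangle_ineq4] add_mono Finite_Cartesian_Product.norm_nth_le)
      also have "\<dots> \<le> 2 * K * dist x y"
        using lipschitz_onD[OF g(1), of x y] by (simp add: dist_norm)
      finally show "dist (g x $ i - g x $ k) (g y $ i - g y $ k) \<le> 2 * K * dist x y" .
    qed (use lipschitz_on_nonneg[OF g(1)] in simp)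
    from AE_zero_imp_partial_deriv_zero[OF this, of j]
    show ?thesis
    proof eventually_elim
      case (elim x)
      show ?case
      proof (intro impI; elim conjE)
        assume x: "x \<in> U" and eq: "f x $ i = f x $ k" and pd: "partially_differentiable j f x"
        have "((\<lambda>t. g (x + t *\<^sub>R axis j 1) $ i - g (x + t *\<^sub>R axis j 1) $ k) has_vector_derivative 0) (at 0)"
          using elim x eq g(2) by simp
        then have "((\<lambda>t. f (x + t *\<^sub>R axis j 1) $ i - f (x + t *\<^sub>R axis j 1) $ k) has_vector_derivative 0) (at 0)"
          by (rule has_vector_derivative_axis_cong[OF assms(1) x, where g = "\<lambda>y. g y $ i - g y $ k" and f = "\<lambda>y. f y $ i - f y $ k", rotated])
             (simp add: g(2))
        moreover have "((\<lambda>t. f (x + t *\<^sub>R axis j 1) $ i - f (x + t *\<^sub>R axis j 1) $ k)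
            has_vector_derivative partial_deriv j f x $ i - partial_deriv j f x $ k) (at 0)"
          by (intro has_vector_derivative_diff
              bounded_linear.has_vector_derivative[OF bounded_linear_vec_nth]
              partially_differentiable_has_vector_derivative pd)
        ultimately have "0 = partial_deriv j f x $ i - partial_deriv j f x $ k"
          by (rule vector_derivative_unique_at)
        then show "partial_deriv j f x $ i = partial_deriv j f x $ k" by simp
      qed
    qed
  qed
  then have "AE x in lborel. \<forall>i\<in>UNIV. \<forall>k\<in>UNIV. x \<in> U \<and> partially_differentiable j f x \<longrightarrow> f x $ i = f x $ k \<longrightarrow>
      partial_deriv j f x $ i = partial_deriv j f x $ k"
    by (intro AE_ball_countable' countable_finite) auto
  with AE_partially_differentiable_C01[OF assms, of j] show ?thesis
    by eventually_elim blast
qed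

lemma AE_tendsto_C01:
  fixes f :: "real^'m \<Rightarrow> 'b::euclidean_space"
  assumes U: "open U" and f: "f \<in> C01 U" and F: "\<And>n. F n \<in> C01 U"
    and lim: "tendsto_Linf_on_axis_segments U F f"
  shows "AE x in lborel. x \<in> U \<longrightarrow> (\<lambda>n. F n x) \<longlonglongrightarrow> f x"
proof -
  have ext: "\<exists>h. continuous_on UNIV h \<and> (\<forall>x\<in>U. h x = k x)" if k: "k \<in> C01 U" for k :: "real^'m \<Rightarrow> 'b"
  proof -
    obtain L where "L-lipschitz_on U k" using C01_lipschitz[OF k] .
    then obtain K h where "K-lipschitz_on UNIV h" "\<And>x. x \<in> U \<Longrightarrow> h x = k x"
      using lipschitz_extension by blast
    then show ?thesis using lipschitz_on_continuous_on by blast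
  qed
  obtain g where g: "continuous_on UNIV g" "\<And>x. x \<in> U \<Longrightarrow> g x = f x"
    using ext[OF f] by blast
  have "\<forall>n. \<exists>h. continuous_on UNIV h \<and> (\<forall>x\<in>U. h x = F n x)"
    using ext[OF F] by blast
  then obtain G where G: "\<And>n. continuous_on UNIV (G n)" "\<And>n x. x \<in> U \<Longrightarrow> G n x = F n x"
    by metis
  show ?thesis
    by (rule AE_tendsto_if_tendsto_Linf_on_axis_segments[OF U G g lim])
qed

text \<open>The norm of \<open>F n - f\<close> bounds both its values and its Lipschitz constant,
  and the latter bounds the partial derivatives of the difference wherever they exist.\<close>

lemma C01_tendsto_pointwise:
  fixes f :: "real^'m \<Rightarrow> 'b::real_normed_vector"
  assumes lim: "C01_tendsto U F f" and U: "open U" "x \<in> U"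
  shows "(\<lambda>n. F n x) \<longlonglongrightarrow> f x"
    and "partially_differentiable j f x \<Longrightarrow> (\<And>n. partially_differentiable j (F n) x) \<Longrightarrow>
      (\<lambda>n. partial_deriv j (F n) x) \<longlonglongrightarrow> partial_deriv j f x"
proof -
  have ev: "\<forall>\<^sub>F n in sequentially. C01_norm U (\<lambda>x. F n x - f x) < ennreal e" if "e > 0" for e
    using lim that unfolding C01_tendsto_def by (intro order_tendstoD(2)) auto
  show "(\<lambda>n. F n x) \<longlonglongrightarrow> f x"
  proof (rule tendstoI)
    fix e :: real assume e: "e > 0"
    then have "e / 2 > 0" by simp
    from ev[OF this] show "\<forall>\<^sub>F n in sequentially. dist (F n x) (f x) < e"
    proof eventually_elim
      case (elim n)
      then have "norm (F n x - f x) \<le> e / 2"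
        using e U(2) by (intro C01_norm_leD(1)[where f = "\<lambda>x. F n x - f x"]) auto
      then show ?case using e by (simp add: dist_norm)
    qed
  qed
  assume pd: "partially_differentiable j f x" "\<And>n. partially_differentiable j (F n) x"
  show "(\<lambda>n. partial_deriv j (F n) x) \<longlonglongrightarrow> partial_deriv j f x"
  proof (rule tendstoI)
    fix e :: real assume e: "e > 0"
    then have "e / 2 > 0" by simp
    from ev[OF this] show "\<forall>\<^sub>F n in sequentially. dist (partial_deriv j (F n) x) (partial_deriv j f x) < e"
    proof eventually_elim
      case (elim n)
      then have lip: "(e / 2)-lipschitz_on U (\<lambda>x. F n x - f x)"
        using e by (intro C01_norm_leD(2)) auto
      have "\<forall>\<^sub>F t in at 0. x + t *\<^sub>R axis j 1 \<in> U"
        using eventually_mem_open_axis[OF U, of j] by (simp add: eventually_at_filter eventually_mono)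
      then have "\<forall>\<^sub>F t in at 0. norm ((F n (x + t *\<^sub>R axis j 1) - f (x + t *\<^sub>R axis j 1)) -
          (F n (x + 0 *\<^sub>R axis j 1) - f (x + 0 *\<^sub>R axis j 1))) \<le> e / 2 * \<bar>t\<bar>"
      proof eventually_elim
        case (elim t)
        from lipschitz_onD[OF lip elim U(2)] show ?case by (simp add: dist_norm)
      qed
      moreover have "((\<lambda>t. F n (x + t *\<^sub>R axis j 1) - f (x + t *\<^sub>R axis j 1)) has_vector_derivative
          partial_deriv j (F n) x - partial_deriv j f x) (at 0)"
        by (intro has_vector_derivative_diff partially_differentiable_has_vector_derivative pd)
      ultimately have "norm (partial_deriv j (F n) x - partial_deriv j f x) \<le> e / 2"
        by (intro norm_vector_derivative_le)
      then show ?case using e by (simp add: dist_norm)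
    qed
  qed
qed

theorem theorem1p14:
  fixes U :: "(real^'m) set"
    and A :: "real^'m \<Rightarrow> complex^'d^'d"
    and A_seq :: "nat \<Rightarrow> real^'m \<Rightarrow> complex^'d^'d"
    and l :: "real^'m \<Rightarrow> complex^'d"
    and l_seq :: "nat \<Rightarrow> real^'m \<Rightarrow> complex^'d"
  assumes "open U" and "bounded U"
    and "A \<in> C01_normal U" and "\<And>n. A_seq n \<in> C01_normal U"
    and "C01_tendsto U A_seq A"
    and "l \<in> C01 U" and "\<And>n. l_seq n \<in> C01 U"
    and "eigenvalue_parameterization U A l"
    and "\<And>n. eigenvalue_parameterization U (A_seq n) (l_seq n)"
    and "tendsto_Linf_on_axis_segments U l_seq l"
  shows "\<forall>j. AE x\<in>U in lebesgue.
           partially_differentiable j l x \<and>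
           (\<forall>n. partially_differentiable j (l_seq n) x) \<and>
           (\<lambda>n. partial_deriv j (l_seq n) x) \<longlonglongrightarrow> partial_deriv j l x"
proof
  fix j
  note U = \<open>open U\<close>
  have A: "A \<in> C01 U" "\<And>x. x \<in> U \<Longrightarrow> A x \<in> normal_matrices"
    and An: "\<And>n. A_seq n \<in> C01 U" "\<And>n x. x \<in> U \<Longrightarrow> A_seq n x \<in> normal_matrices"
    using assms(3,4) closure_subset[of U] by (auto simp: C01_normal_def)
  have eig: "eigenvalues_with_mult (A x) (l x)" "eigenvalues_with_mult (A_seq n x) (l_seq n x)" if "x \<in> U" for x n
    using assms(8,9) that by (auto simp: eigenvalue_parameterization_def)
  have pd_seq: "AE x in lborel. \<forall>n. x \<in> U \<longrightarrow>
      partially_differentiable j (A_seq n) x \<and> partially_differentiable j (l_seq n) x"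
    unfolding AE_all_countable
  proof
    fix n
    show "AE x in lborel. x \<in> U \<longrightarrow> partially_differentiable j (A_seq n) x \<and> partially_differentiable j (l_seq n) x"
      using AE_partially_differentiable_C01[OF U An(1)[of n], of j] AE_partially_differentiable_C01[OF U assms(7)[of n], of j]
      by eventually_elim blast
  qed
  have "AE x in lborel. x \<in> U \<longrightarrow>
      partially_differentiable j l x \<and> (\<forall>n. partially_differentiable j (l_seq n) x) \<and>
      (\<lambda>n. partial_deriv j (l_seq n) x) \<longlonglongrightarrow> partial_deriv j l x"
    using AE_partially_differentiable_C01[OF U A(1), of j] AE_partially_differentiable_C01[OF U assms(6), of j]
      pd_seq AE_equal_components_imp_equal_partial_derivs[OF U assms(6), of j]
      AE_tendsto_C01[OF U assms(6,7,10)]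
  proof eventually_elim
    case (elim x)
    show ?case
    proof
      assume x: "x \<in> U"
      let ?p = "\<lambda>t. x + t *\<^sub>R axis j 1"
      have pd: "partially_differentiable j A x" "partially_differentiable j l x"
          "\<And>n. partially_differentiable j (A_seq n) x" "\<And>n. partially_differentiable j (l_seq n) x"
        and same: "\<And>i k. l x $ i = l x $ k \<Longrightarrow> partial_deriv j l x $ i = partial_deriv j l x $ k"
        and lim: "(\<lambda>n. l_seq n x) \<longlonglongrightarrow> l x"
        using elim x by blast+
      have evU: "\<forall>\<^sub>F t in at 0. ?p t \<in> U"
        using eventually_mem_open_axis[OF U x, of j] by (simp add: eventually_at_filter eventually_mono)
      \<comment> \<open>At fixed \<open>x\<close> and \<open>i\<close> three things remain:
        convergence of the matrices, their derivatives and the eigenvalue; a representing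
        eigenvector for each \<open>n\<close>; constancy of the limit form on the
        eigenspace.\<close>
      have "(\<lambda>n. partial_deriv j (l_seq n) x $ i) \<longlonglongrightarrow> partial_deriv j l x $ i" for i
      proof (rule tendsto_cinner_on_eigenvectors)
        show "(\<lambda>n. A_seq n x) \<longlonglongrightarrow> A x" "(\<lambda>n. partial_deriv j (A_seq n) x) \<longlonglongrightarrow> partial_deriv j A x"
          using C01_tendsto_pointwise[OF assms(5) U x] pd by auto
        show "(\<lambda>n. l_seq n x $ i) \<longlonglongrightarrow> l x $ i"
          by (intro tendsto_intros lim)
      next
        fix n
        have "\<exists>v. norm v = 1 \<and> A_seq n (?p 0) *v v = l_seq n (?p 0) $ i *s v \<and>
            cinner (partial_deriv j (A_seq n) x *v v) v = partial_deriv j (l_seq n) x $ i"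
        proof (rule eigenvalue_derivative_eq_cinner[where B = "\<lambda>t. A_seq n (?p t)" and \<mu> = "\<lambda>t. l_seq n (?p t) $ i"])
          show "\<forall>\<^sub>F t in at 0. \<exists>v. norm v = 1 \<and> A_seq n (?p t) *v v = l_seq n (?p t) $ i *s v"
            using evU by eventually_elim (intro eigenvalues_with_mult_unit_eigenvector eig)
          show "A_seq n (?p 0) \<in> normal_matrices" using An(2) x by simp
        qed (intro partially_differentiable_has_vector_derivative pd
            bounded_linear.has_vector_derivative[OF bounded_linear_vec_nth])+
        then show "\<exists>v. norm v = 1 \<and> A_seq n x *v v = l_seq n x $ i *s v \<and>
            cinner (partial_deriv j (A_seq n) x *v v) v = partial_deriv j (l_seq n) x $ i"
          by simp
      next
        fix w :: "complex^'d"
        assume w: "norm w = 1" "A x *v w = l x $ i *s w"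
        show "cinner (partial_deriv j A x *v w) w = partial_deriv j l x $ i"
        proof (rule eigenvalue_derivative_constant_on_eigenspace[where B = "\<lambda>t. A (?p t)" and l = "\<lambda>t. l (?p t)" and z = "l x $ i"])
          show "\<forall>\<^sub>F t in at 0. A (?p t) \<in> normal_matrices \<and> eigenvalues_with_mult (A (?p t)) (l (?p t))"
            using evU by eventually_elim (simp add: A(2) eig(1))
          \<comment> \<open>The exclusion of a null set pays off here: all components meeting
            \<open>l x $ i\<close> at \<open>x\<close> share its partial derivative.\<close>
          show "partial_deriv j l x $ k = partial_deriv j l x $ i" if "l (?p 0) $ k = l x $ i" for k
            by (rule same) (use that in simp)
          show "A (?p 0) *v w = l x $ i *s w" using w(2) by simp
        qed (intro w(1) partially_differentiable_has_vector_derivative pd)+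
      qed
      then show "partially_differentiable j l x \<and> (\<forall>n. partially_differentiable j (l_seq n) x) \<and>
          (\<lambda>n. partial_deriv j (l_seq n) x) \<longlonglongrightarrow> partial_deriv j l x"
        using pd(2,4) by (intro conjI allI vec_tendstoI)
    qed
  qed
  \<comment> \<open>Everything so far concerned \<open>lborel\<close>; Lebesgue measure is its
    completion.\<close>
  then show "AE x\<in>U in lebesgue. partially_differentiable j l x \<and> (\<forall>n. partially_differentiable j (l_seq n) x) \<and>
      (\<lambda>n. partial_deriv j (l_seq n) x) \<longlonglongrightarrow> partial_deriv j l x"
    by (rule AE_completion)
qed

end
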